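(* Every finitely presented group $G$ admits a finite symmetric generating set $S\subseteq G\setminus\{1\}$ such that the Cayley graph $\mathrm{Cay}(G,S)$ is LG-rigid.
   Context: Given a group $G$ and a symmetric generating set $S\subseteq G\setminus\{1\}$ (that is, $S=S^{-1}$), the Cayley graph $\mathrm{Cay}(G,S)$ is the simple unoriented graph with vertex set $G$ and an edge between $g$ and $h$ precisely when $g^{-1}h\in S$. Graphs are simple, unoriented and connected, with the graph distance on vertices. Given two graphs $X$ and $Y$ and a positive integer $R$, we say that $Y$ is $R$-locally $X$ if every ball of radius $R$ in $Y$ appears as a ball of radius $R$ in $X$ (i.e. for every vertex $y$ of $Y$ there is a vertex $x$ of $X$ and an isomorphism from the ball of radius $R$ around $y$ onto the ball of radius $R$ around $x$ sending $y$ to $x$). A graph $X$ is local to global rigid (LG-rigid) if there is $R>0$ such that any graph that is $R$-locally $X$ is covered by $X$. Here $X$ covers $Y$ if there is a surjective map from the vertices of $X$ to the vertices of $Y$ which, for every vertex $x$ of $X$, restricts to a bijection from the set of neighbours of $x$ onto the set of neighbours of its image. *)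

theory Defs
  imports "HOL-Algebra.Generated_Groups" "Graph_Theory.Digraph_Component"
begin

section \<open>Graphs\<close>

text \<open>
  A simple unoriented graph is a loopfree symmetric digraph without parallel arcs, i.e. a
  \<open>pair_bidirected_digraph\<close>; it may be infinite. For a symmetric digraph,
  \<^const>\<open>strongly_connected\<close> is ordinary connectedness, and it includes that there is
  at least one vertex. The empty graph has to be excluded: it would vacuously be
  \<open>R\<close>-locally \<open>X\<close> for every \<open>X\<close>, but is not covered by any nonempty graph.
\<close>

definition connected_simple_graph :: "'v pair_pre_digraph \<Rightarrow> bool" where
  "connected_simple_graph X \<longleftrightarrow> pair_bidirected_digraph X \<and> strongly_connected (with_proj X)"

definition neighbours :: "'v pair_pre_digraph \<Rightarrow> 'v \<Rightarrow> 'v set" where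
  "neighbours X x = {y. (x, y) \<in> parcs X}"

definition graph_dist :: "'v pair_pre_digraph \<Rightarrow> 'v \<Rightarrow> 'v \<Rightarrow> nat" where
  "graph_dist X x y = (LEAST n. \<exists>p. pre_digraph.awalk (with_proj X) x p y \<and> length p = n)"

text \<open>A ball is the subgraph induced on the vertices at distance at most \<open>R\<close> from its centre.\<close>

definition graph_ball :: "'v pair_pre_digraph \<Rightarrow> 'v \<Rightarrow> nat \<Rightarrow> 'v pair_pre_digraph" where
  "graph_ball X x R =
    (let B = {y \<in> pverts X. graph_dist X x y \<le> R} in \<lparr>pverts = B, parcs = parcs X \<inter> B \<times> B\<rparr>)"

definition graph_isomorphism ::
    "('v \<Rightarrow> 'w) \<Rightarrow> 'v pair_pre_digraph \<Rightarrow> 'w pair_pre_digraph \<Rightarrow> bool" where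
  "graph_isomorphism f X Y \<longleftrightarrow> bij_betw f (pverts X) (pverts Y) \<and>
    (\<forall>u\<in>pverts X. \<forall>v\<in>pverts X. (u, v) \<in> parcs X \<longleftrightarrow> (f u, f v) \<in> parcs Y)"

text \<open>\<open>locally_graph R Y X\<close>: the graph \<open>Y\<close> is \<open>R\<close>-locally \<open>X\<close>.\<close>

definition locally_graph :: "nat \<Rightarrow> 'w pair_pre_digraph \<Rightarrow> 'v pair_pre_digraph \<Rightarrow> bool" where
  "locally_graph R Y X \<longleftrightarrow> (\<forall>y\<in>pverts Y. \<exists>x\<in>pverts X. \<exists>f.
    graph_isomorphism f (graph_ball Y y R) (graph_ball X x R) \<and> f y = x)"

text \<open>\<open>graph_covers X Y\<close>: the graph \<open>X\<close> covers \<open>Y\<close>.\<close>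

definition graph_covers :: "'v pair_pre_digraph \<Rightarrow> 'w pair_pre_digraph \<Rightarrow> bool" where
  "graph_covers X Y \<longleftrightarrow> (\<exists>p. p ` pverts X = pverts Y \<and>
    (\<forall>x\<in>pverts X. bij_betw p (neighbours X x) (neighbours Y (p x))))"

text \<open>
  HOL cannot quantify over vertex types inside a formula, so a single type has to stand for all
  graphs \<open>Y\<close>. Vertices of type \<^typ>\<open>'v list\<close> suffice: a connected graph that is
  \<open>R\<close>-locally \<open>X\<close> with \<open>R > 0\<close> has at most as many vertices as there are finite
  sequences of vertices of \<open>X\<close>. Lemma \<open>LG_rigid_at_any_type\<close> below shows that
  nothing is lost: the same \<open>R\<close> then works for graphs over every vertex type.
\<close>

definition LG_rigid_at :: "nat \<Rightarrow> 'v pair_pre_digraph \<Rightarrow> bool" where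
  "LG_rigid_at R X \<longleftrightarrow> (\<forall>Y :: 'v list pair_pre_digraph.
    connected_simple_graph Y \<longrightarrow> locally_graph R Y X \<longrightarrow> graph_covers X Y)"

definition LG_rigid :: "'v pair_pre_digraph \<Rightarrow> bool" where
  "LG_rigid X \<longleftrightarrow> (\<exists>R>0. LG_rigid_at R X)"

subsection \<open>Independence of the vertex type\<close>

lemma connected_simple_graph_iff:
  "connected_simple_graph X \<longleftrightarrow> parcs X \<subseteq> pverts X \<times> pverts X \<and> sym (parcs X) \<and>
     (\<forall>u. (u, u) \<notin> parcs X) \<and> pverts X \<noteq> {} \<and>
     (\<forall>u\<in>pverts X. \<forall>v\<in>pverts X. (u, v) \<in> (parcs X)\<^sup>*)"
proof -
  have 1: "pair_bidirected_digraph X \<longleftrightarrow> parcs X \<subseteq> pverts X \<times> pverts X \<and> sym (parcs X) \<and>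
     (\<forall>u. (u, u) \<notin> parcs X)"
    by (auto simp: pair_bidirected_digraph_def pair_sym_digraph_def pair_sym_digraph_axioms_def
        pair_loopfree_digraph_def pair_loopfree_digraph_axioms_def pair_wf_digraph_def symmetric_def)
  have 2: "u \<rightarrow>\<^sup>*\<^bsub>with_proj X\<^esub> v \<longleftrightarrow> (u, v) \<in> (parcs X)\<^sup>*"
    if X: "parcs X \<subseteq> pverts X \<times> pverts X" and uv: "u \<in> pverts X" for u v
  proof -
    have "v \<in> pverts X \<and> u \<rightarrow>\<^sup>*\<^bsub>with_proj X\<^esub> v" if "(u, v) \<in> (parcs X)\<^sup>*"
      using that
    proof induction
      case base
      show ?case using uv by (auto simp: reachable_def)
    next
      case (step y z)
      then show ?case using X unfolding reachable_def
        by (auto intro: rtrancl_on_into_rtrancl_on)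
    qed
    then show ?thesis
      by (auto simp: reachable_def dest: rtrancl_on_rtranclI)
  qed
  show ?thesis
    unfolding connected_simple_graph_def 1 strongly_connected_def using 2 by auto
qed

lemma awalk_relpow:
  assumes "parcs X \<subseteq> pverts X \<times> pverts X" "u \<in> pverts X"
  shows "(\<exists>p. pre_digraph.awalk (with_proj X) u p v \<and> length p = n) \<longleftrightarrow> (u, v) \<in> parcs X ^^ n"
proof -
  have aw: "pre_digraph.awalk (with_proj X) u p v \<longleftrightarrow> u \<in> pverts X \<and> set p \<subseteq> parcs X \<and> pcas u p v"
    for u p
    by (simp add: pre_digraph.awalk_def cas_with_proj_eq)
  show ?thesis
    using assms(2)
  proof (induction n arbitrary: u)
    case 0
    then show ?case by (auto simp: aw)
  next
    case (Suc n)
    show ?case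
    proof
      assume "\<exists>p. pre_digraph.awalk (with_proj X) u p v \<and> length p = Suc n"
      then obtain e q where q: "set (e # q) \<subseteq> parcs X" "pcas u (e # q) v" "length q = n"
        by (auto simp: aw length_Suc_conv)
      then have "snd e \<in> pverts X" "(u, snd e) \<in> parcs X"
        using assms(1) by auto
      moreover have "(snd e, v) \<in> parcs X ^^ n"
        using Suc.IH[OF \<open>snd e \<in> pverts X\<close>] q \<open>snd e \<in> pverts X\<close> by (auto simp: aw)
      ultimately show "(u, v) \<in> parcs X ^^ Suc n"
        by (meson relpow_Suc_I2)
    next
      assume "(u, v) \<in> parcs X ^^ Suc n"
      then obtain w where w: "(u, w) \<in> parcs X" "(w, v) \<in> parcs X ^^ n"
        by (meson relpow_Suc_D2)
      then have "w \<in> pverts X" using assms(1) by auto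
      then obtain p where "pre_digraph.awalk (with_proj X) w p v" "length p = n"
        using Suc.IH w(2) by blast
      then show "\<exists>p. pre_digraph.awalk (with_proj X) u p v \<and> length p = Suc n"
        using w(1) Suc.prems by (intro exI[of _ "(u, w) # p"]) (auto simp: aw)
    qed
  qed
qed

lemma graph_dist_relpow:
  assumes "parcs X \<subseteq> pverts X \<times> pverts X" "u \<in> pverts X"
  shows "graph_dist X u v = (LEAST n. (u, v) \<in> parcs X ^^ n)"
  unfolding graph_dist_def awalk_relpow[OF assms] ..

lemma code_vertices:
  fixes X :: "'v pair_pre_digraph" and Y :: "'w pair_pre_digraph"
  assumes Y: "connected_simple_graph Y" and R: "R > 0" and loc: "locally_graph R Y X"
  shows "\<exists>c :: 'w \<Rightarrow> 'v list. inj_on c (pverts Y)"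
proof -
  have wf: "parcs Y \<subseteq> pverts Y \<times> pverts Y"
    and conn: "\<And>u v. u \<in> pverts Y \<Longrightarrow> v \<in> pverts Y \<Longrightarrow> (u, v) \<in> (parcs Y)\<^sup>*"
    using Y by (auto simp: connected_simple_graph_iff)
  obtain y0 where y0: "y0 \<in> pverts Y"
    using Y by (auto simp: connected_simple_graph_iff)
  have "\<exists>f :: 'w \<Rightarrow> 'v. inj_on f (neighbours Y y)" if y: "y \<in> pverts Y" for y
  proof -
    obtain f :: "'w \<Rightarrow> 'v" where f: "inj_on f (pverts (graph_ball Y y R))"
      using loc y by (force simp: locally_graph_def graph_isomorphism_def bij_betw_def)
    have "neighbours Y y \<subseteq> pverts (graph_ball Y y R)"
    proof
      fix z assume z: "z \<in> neighbours Y y"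
      then have "(y, z) \<in> parcs Y ^^ 1" by (auto simp: neighbours_def)
      then have "graph_dist Y y z \<le> 1"
        unfolding graph_dist_relpow[OF wf y] by (rule Least_le)
      then show "z \<in> pverts (graph_ball Y y R)"
        using z R wf by (auto simp: graph_ball_def Let_def neighbours_def)
    qed
    with f show ?thesis by (meson inj_on_subset)
  qed
  then obtain \<phi> :: "'w \<Rightarrow> 'w \<Rightarrow> 'v" where \<phi>: "\<And>y. y \<in> pverts Y \<Longrightarrow> inj_on (\<phi> y) (neighbours Y y)"
    by metis
  define dec :: "'v list \<Rightarrow> 'w" where
    "dec = rec_list y0 (\<lambda>a w d. inv_into (neighbours Y d) (\<phi> d) a)"
  have dec: "dec [] = y0" "dec (a # w) = inv_into (neighbours Y (dec w)) (\<phi> (dec w)) a" for a w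
    by (auto simp: dec_def)
  have "y \<in> range dec" if "(y0, y) \<in> (parcs Y)\<^sup>*" for y
    using that
  proof induction
    case base
    show ?case using dec(1) by (metis rangeI)
  next
    case (step y z)
    then obtain w where w: "y = dec w" by auto
    have "z \<in> neighbours Y y" "y \<in> pverts Y"
      using step wf by (auto simp: neighbours_def)
    then have "dec (\<phi> y z # w) = z"
      using \<phi> by (simp add: dec(2) w[symmetric])
    then show ?case by (metis rangeI)
  qed
  then have "pverts Y \<subseteq> range dec"
    using conn y0 by blast
  then show ?thesis
    using inj_on_inv_into by blast
qed

lemma LG_rigid_at_any_type:
  fixes X :: "'v pair_pre_digraph" and Y :: "'w pair_pre_digraph"
  assumes rigid: "LG_rigid_at R X" and R: "R > 0"
    and Y: "connected_simple_graph Y" and loc: "locally_graph R Y X"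
  shows "graph_covers X Y"
proof -
  obtain c :: "'w \<Rightarrow> 'v list" where c: "inj_on c (pverts Y)"
    using code_vertices[OF Y R loc] by blast
  define Z where "Z = \<lparr>pverts = c ` pverts Y, parcs = map_prod c c ` parcs Y\<rparr>"
  have wf: "parcs Y \<subseteq> pverts Y \<times> pverts Y"
    and sym: "sym (parcs Y)" and irr: "\<And>u. (u, u) \<notin> parcs Y"
    and conn: "\<And>u v. u \<in> pverts Y \<Longrightarrow> v \<in> pverts Y \<Longrightarrow> (u, v) \<in> (parcs Y)\<^sup>*"
    using Y by (auto simp: connected_simple_graph_iff)
  have Zv: "pverts Z = c ` pverts Y" by (simp add: Z_def)
  have wfZ: "parcs Z \<subseteq> pverts Z \<times> pverts Z"
    using wf by (auto simp: Z_def)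
  have Ze: "(c u, c v) \<in> parcs Z \<longleftrightarrow> (u, v) \<in> parcs Y" if "u \<in> pverts Y" "v \<in> pverts Y" for u v
  proof
    assume "(c u, c v) \<in> parcs Z"
    then obtain u' v' where uv': "(u', v') \<in> parcs Y" "c u = c u'" "c v = c v'"
      by (auto simp: Z_def)
    moreover have "u' \<in> pverts Y" "v' \<in> pverts Y" using uv' wf by auto
    ultimately show "(u, v) \<in> parcs Y" using that c by (metis inj_on_def)
  qed (auto simp: Z_def)
  have pow: "(c u, c v) \<in> parcs Z ^^ n \<longleftrightarrow> (u, v) \<in> parcs Y ^^ n"
    if "u \<in> pverts Y" "v \<in> pverts Y" for u v n
    using that(2)
  proof (induction n arbitrary: v)
    case 0
    then show ?case using that(1) c by (auto simp: inj_on_eq_iff)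
  next
    case (Suc n)
    show ?case
    proof
      assume "(c u, c v) \<in> parcs Z ^^ Suc n"
      then obtain w' where w': "(c u, w') \<in> parcs Z ^^ n" "(w', c v) \<in> parcs Z" by auto
      then obtain w where "w \<in> pverts Y" "w' = c w" using wfZ Zv by auto
      with w' Suc show "(u, v) \<in> parcs Y ^^ Suc n" by (auto simp: Ze)
    next
      assume "(u, v) \<in> parcs Y ^^ Suc n"
      then obtain w where w: "(u, w) \<in> parcs Y ^^ n" "(w, v) \<in> parcs Y" by auto
      then have "w \<in> pverts Y" using wf by auto
      with w Suc have "(c u, c w) \<in> parcs Z ^^ n" "(c w, c v) \<in> parcs Z" by (simp_all add: Ze)
      then show "(c u, c v) \<in> parcs Z ^^ Suc n" by auto
    qed
  qed
  have dist: "graph_dist Z (c u) (c v) = graph_dist Y u v"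
    if "u \<in> pverts Y" "v \<in> pverts Y" for u v
    using graph_dist_relpow[OF wf that(1)] graph_dist_relpow[OF wfZ, of "c u"] that pow[OF that]
    by (simp add: Zv)
  have Zg: "connected_simple_graph Z"
    unfolding connected_simple_graph_iff
  proof (intro conjI ballI allI)
    show "parcs Z \<subseteq> pverts Z \<times> pverts Z" by (rule wfZ)
    show "sym (parcs Z)"
    proof (rule symI)
      fix a b assume "(a, b) \<in> parcs Z"
      then show "(b, a) \<in> parcs Z" using sym by (force simp: Z_def dest: symD)
    qed
    show "(u, u) \<notin> parcs Z" for u
    proof
      assume u: "(u, u) \<in> parcs Z"
      then obtain v where "v \<in> pverts Y" "u = c v" using wfZ Zv by auto
      with u irr Ze show False by auto
    qed
    show "pverts Z \<noteq> {}"
      using Y by (auto simp: Zv connected_simple_graph_iff)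
    show "(a, b) \<in> (parcs Z)\<^sup>*" if ab: "a \<in> pverts Z" "b \<in> pverts Z" for a b
    proof -
      obtain u v where uv: "u \<in> pverts Y" "a = c u" "v \<in> pverts Y" "b = c v"
        using ab by (auto simp: Zv)
      then obtain n where "(u, v) \<in> parcs Y ^^ n"
        using conn rtrancl_imp_relpow by metis
      with uv pow show ?thesis by (metis relpow_imp_rtrancl)
    qed
  qed
  define h where "h = inv_into (pverts Y) c"
  have hc: "h (c v) = v" if "v \<in> pverts Y" for v
    using that c by (simp add: h_def)
  have "locally_graph R Z X"
    unfolding locally_graph_def
  proof
    fix z assume "z \<in> pverts Z"
    then obtain y where y: "y \<in> pverts Y" "z = c y" by (auto simp: Zv)
    then obtain x f where x: "x \<in> pverts X" "f y = x"
      and f: "graph_isomorphism f (graph_ball Y y R) (graph_ball X x R)"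
      using loc by (auto simp: locally_graph_def)
    have B: "pverts (graph_ball Z z R) = c ` pverts (graph_ball Y y R)"
      using dist y by (auto simp: graph_ball_def Let_def Zv)
    have sub: "pverts (graph_ball Y y R) \<subseteq> pverts Y"
      by (auto simp: graph_ball_def Let_def)
    have E: "(c u, c v) \<in> parcs (graph_ball Z z R) \<longleftrightarrow> (u, v) \<in> parcs (graph_ball Y y R)"
      if "u \<in> pverts Y" "v \<in> pverts Y" for u v
      using that dist y Ze by (auto simp: graph_ball_def Let_def Zv)
    have "graph_isomorphism (f \<circ> h) (graph_ball Z z R) (graph_ball X x R)"
      unfolding graph_isomorphism_def
    proof (intro conjI ballI)
      have "bij_betw h (pverts (graph_ball Z z R)) (pverts (graph_ball Y y R))"
        using hc sub by (intro bij_betw_byWitness[where f' = c]) (auto simp: B)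
      then show "bij_betw (f \<circ> h) (pverts (graph_ball Z z R)) (pverts (graph_ball X x R))"
        using f unfolding graph_isomorphism_def by (blast intro: bij_betw_trans)
      fix a b assume "a \<in> pverts (graph_ball Z z R)" "b \<in> pverts (graph_ball Z z R)"
      then obtain u v where uv: "u \<in> pverts (graph_ball Y y R)" "a = c u"
        "v \<in> pverts (graph_ball Y y R)" "b = c v"
        by (auto simp: B)
      then show "(a, b) \<in> parcs (graph_ball Z z R) \<longleftrightarrow> ((f \<circ> h) a, (f \<circ> h) b) \<in> parcs (graph_ball X x R)"
        using E sub hc f unfolding graph_isomorphism_def by (simp add: subset_iff)
    qed
    then show "\<exists>x\<in>pverts X. \<exists>f. graph_isomorphism f (graph_ball Z z R) (graph_ball X x R) \<and> f z = x"
      using x y hc by (intro bexI[of _ x] exI[of _ "f \<circ> h"]) auto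
  qed
  with rigid Zg obtain p where p: "p ` pverts X = pverts Z"
    "\<And>x. x \<in> pverts X \<Longrightarrow> bij_betw p (neighbours X x) (neighbours Z (p x))"
    by (auto simp: LG_rigid_at_def graph_covers_def)
  show ?thesis
    unfolding graph_covers_def
  proof (intro exI[of _ "h \<circ> p"] conjI ballI)
    have "(h \<circ> p) ` pverts X = h ` c ` pverts Y"
      by (metis image_comp p(1) Zv)
    then show "(h \<circ> p) ` pverts X = pverts Y"
      using hc by (auto simp: image_iff)
    fix x assume x: "x \<in> pverts X"
    then obtain y where y: "y \<in> pverts Y" "p x = c y" using p(1) Zv by blast
    have nb: "neighbours Z (c y) = c ` neighbours Y y"
    proof (intro equalityI subsetI)
      fix a assume "a \<in> neighbours Z (c y)"
      then have a: "(c y, a) \<in> parcs Z" by (simp add: neighbours_def)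
      then obtain v where v: "v \<in> pverts Y" "a = c v" using wfZ Zv by blast
      then have "(y, v) \<in> parcs Y" using a Ze[OF y(1) v(1)] by simp
      then show "a \<in> c ` neighbours Y y" using v(2) by (simp add: neighbours_def)
    next
      fix a assume "a \<in> c ` neighbours Y y"
      then obtain v where v: "(y, v) \<in> parcs Y" "a = c v" by (auto simp: neighbours_def)
      then have "v \<in> pverts Y" using wf by auto
      then show "a \<in> neighbours Z (c y)" using v Ze[OF y(1)] by (simp add: neighbours_def)
    qed
    have "neighbours Y y \<subseteq> pverts Y" using wf by (auto simp: neighbours_def)
    then have "bij_betw h (neighbours Z (p x)) (neighbours Y y)"
      using hc by (intro bij_betw_byWitness[where f' = c]) (auto simp: nb y)
    then show "bij_betw (h \<circ> p) (neighbours X x) (neighbours Y ((h \<circ> p) x))"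
      using p(2)[OF x] y hc by (auto intro: bij_betw_trans)
  qed
qed

section \<open>Cayley graphs\<close>

definition Cay :: "('a, 'b) monoid_scheme \<Rightarrow> 'a set \<Rightarrow> 'a pair_pre_digraph" where
  "Cay G S = \<lparr>pverts = carrier G,
    parcs = {(g, h). g \<in> carrier G \<and> h \<in> carrier G \<and> inv\<^bsub>G\<^esub> g \<otimes>\<^bsub>G\<^esub> h \<in> S}\<rparr>"

lemma connected_simple_graph_Cay:
  fixes G (structure)
  assumes "group G" and S: "S \<subseteq> carrier G - {\<one>}" and symS: "m_inv G ` S = S"
    and gen: "generate G S = carrier G"
  shows "connected_simple_graph (Cay G S)"
proof -
  interpret group G by fact
  have edge: "(g, g \<otimes> s) \<in> parcs (Cay G S)" if "g \<in> carrier G" "s \<in> S" for g s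
    using that S by (auto simp: Cay_def m_assoc[symmetric])
  have symE: "sym (parcs (Cay G S))"
  proof (rule symI)
    fix g h assume "(g, h) \<in> parcs (Cay G S)"
    then have gh: "g \<in> carrier G" "h \<in> carrier G" "inv g \<otimes> h \<in> S" by (auto simp: Cay_def)
    then have "inv (inv g \<otimes> h) \<in> S" using symS by blast
    then show "(h, g) \<in> parcs (Cay G S)" using gh by (auto simp: Cay_def inv_mult_group)
  qed
  have path: "\<forall>g\<in>carrier G. (g, g \<otimes> k) \<in> (parcs (Cay G S))\<^sup>*" if "k \<in> generate G S" for k
    using that
  proof induction
    case one
    then show ?case by auto
  next
    case (incl s)
    then show ?case using edge by blast
  next
    case (inv s)
    then have "inv s \<in> S" using symS by blast
    then show ?case using edge by blast
  next
    case (eng k l)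
    have kl: "k \<in> carrier G" "l \<in> carrier G" using eng(1,2) gen by auto
    show ?case
    proof
      fix g assume g: "g \<in> carrier G"
      have "(g, g \<otimes> k) \<in> (parcs (Cay G S))\<^sup>*" using eng g by blast
      also have "(g \<otimes> k, g \<otimes> k \<otimes> l) \<in> (parcs (Cay G S))\<^sup>*" using eng g kl by blast
      finally show "(g, g \<otimes> (k \<otimes> l)) \<in> (parcs (Cay G S))\<^sup>*" using g kl by (simp add: m_assoc)
    qed
  qed
  show ?thesis
    unfolding connected_simple_graph_iff
  proof (intro conjI ballI allI)
    show "(g, g) \<notin> parcs (Cay G S)" for g using S by (auto simp: Cay_def)
    show "(g, h) \<in> (parcs (Cay G S))\<^sup>*" if "g \<in> pverts (Cay G S)" "h \<in> pverts (Cay G S)" for g h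
    proof -
      have gh: "g \<in> carrier G" "h \<in> carrier G" using that by (auto simp: Cay_def)
      then have "inv g \<otimes> h \<in> generate G S" by (simp add: gen)
      then have "(g, g \<otimes> (inv g \<otimes> h)) \<in> (parcs (Cay G S))\<^sup>*" using path gh by blast
      then show ?thesis using gh by (simp add: m_assoc[symmetric])
    qed
  qed (use symE in \<open>auto simp: Cay_def\<close>)
qed

section \<open>Finitely presented groups\<close>

text \<open>The letters \<open>(x, True)\<close> and \<open>(x, False)\<close> stand for \<open>x\<close> and its formal inverse.\<close>

type_synonym 'x word = "('x \<times> bool) list"

definition words :: "'x set \<Rightarrow> 'x word set" where
  "words X = lists (X \<times> UNIV)"

inductive free_eq :: "'x set \<Rightarrow> 'x word \<Rightarrow> 'x word \<Rightarrow> bool" for X where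
  free_refl: "w \<in> words X \<Longrightarrow> free_eq X w w"
| free_sym: "free_eq X v w \<Longrightarrow> free_eq X w v"
| free_trans: "free_eq X u v \<Longrightarrow> free_eq X v w \<Longrightarrow> free_eq X u w"
| free_cancel: "u \<in> words X \<Longrightarrow> v \<in> words X \<Longrightarrow> x \<in> X \<Longrightarrow>
    free_eq X (u @ [(x, b), (x, \<not> b)] @ v) (u @ v)"

definition free_rel :: "'x set \<Rightarrow> 'x word rel" where
  "free_rel X = {(u, v). free_eq X u v}"

definition free_group :: "'x set \<Rightarrow> 'x word set monoid" where
  "free_group X = \<lparr>carrier = words X // free_rel X,
    monoid.mult = (\<lambda>A B. \<Union>u\<in>A. \<Union>v\<in>B. free_rel X `` {u @ v}),
    monoid.one = free_rel X `` {[]}\<rparr>"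

definition normal_closure :: "('a, 'b) monoid_scheme \<Rightarrow> 'a set \<Rightarrow> 'a set" where
  "normal_closure G A = \<Inter>{N. N \<lhd> G \<and> A \<subseteq> N}"

text \<open>The generators of a finite presentation may be named by natural numbers.\<close>

definition finitely_presented :: "('a, 'b) monoid_scheme \<Rightarrow> bool" where
  "finitely_presented G \<longleftrightarrow> (\<exists>(X :: nat set) Rel. finite X \<and> finite Rel \<and>
    Rel \<subseteq> carrier (free_group X) \<and>
    free_group X Mod normal_closure (free_group X) Rel \<cong> G)"

lemma words_append: "u @ v \<in> words X \<longleftrightarrow> u \<in> words X \<and> v \<in> words X"
  by (auto simp: words_def)

lemma free_eq_words: "free_eq X u v \<Longrightarrow> u \<in> words X \<and> v \<in> words X"
  by (induction rule: free_eq.induct) (auto simp: words_def)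

lemma equiv_free_rel: "equiv (words X) (free_rel X)"
proof (intro equivI refl_onI symI transI)
  show "free_rel X \<subseteq> words X \<times> words X" using free_eq_words by (auto simp: free_rel_def)
  show "(w, w) \<in> free_rel X" if "w \<in> words X" for w
    using that by (simp add: free_rel_def free_refl)
  show "(w, v) \<in> free_rel X" if "(v, w) \<in> free_rel X" for v w
    using that by (simp add: free_rel_def free_sym)
  show "(u, w) \<in> free_rel X" if "(u, v) \<in> free_rel X" "(v, w) \<in> free_rel X" for u v w
    using that free_trans[of X u v w] by (simp add: free_rel_def)
qed

lemma free_eq_append_right: "free_eq X u v \<Longrightarrow> w \<in> words X \<Longrightarrow> free_eq X (u @ w) (v @ w)"
proof (induction rule: free_eq.induct)
  case (free_cancel u v x b)
  then show ?case using free_eq.free_cancel[of u X "v @ w" x b] by (simp add: words_append)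
next
  case (free_refl u)
  then show ?case by (simp add: free_eq.free_refl words_append)
next
  case (free_sym u v)
  then show ?case by (blast intro: free_eq.free_sym)
next
  case (free_trans u v z)
  then show ?case by (meson free_eq.free_trans)
qed

lemma free_eq_append_left: "free_eq X u v \<Longrightarrow> w \<in> words X \<Longrightarrow> free_eq X (w @ u) (w @ v)"
proof (induction rule: free_eq.induct)
  case (free_cancel u v x b)
  then show ?case using free_eq.free_cancel[of "w @ u" X v x b] by (simp add: words_append)
next
  case (free_refl u)
  then show ?case by (simp add: free_eq.free_refl words_append)
next
  case (free_sym u v)
  then show ?case by (blast intro: free_eq.free_sym)
next
  case (free_trans u v z)
  then show ?case by (meson free_eq.free_trans)
qed

lemma free_eq_append: "free_eq X u u' \<Longrightarrow> free_eq X v v' \<Longrightarrow> free_eq X (u @ v) (u' @ v')"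
proof -
  assume u: "free_eq X u u'" and v: "free_eq X v v'"
  have "free_eq X (u @ v) (u' @ v)"
    using free_eq_append_right[OF u] free_eq_words[OF v] by blast
  moreover have "free_eq X (u' @ v) (u' @ v')"
    using free_eq_append_left[OF v] free_eq_words[OF u] by blast
  ultimately show "free_eq X (u @ v) (u' @ v')" by (rule free_trans)
qed

lemma free_group_mult:
  assumes "u \<in> words X" "v \<in> words X"
  shows "(free_rel X `` {u}) \<otimes>\<^bsub>free_group X\<^esub> (free_rel X `` {v}) = free_rel X `` {u @ v}"
proof -
  let ?c = "\<lambda>w. free_rel X `` {w}"
  have "?c (u' @ v') = ?c (u @ v)" if "u' \<in> ?c u" "v' \<in> ?c v" for u' v'
  proof -
    have "free_eq X (u @ v) (u' @ v')"
      using that by (intro free_eq_append) (simp_all add: free_rel_def)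
    then show ?thesis
      using equiv_class_eq[OF equiv_free_rel, of "u @ v" "u' @ v'" X] by (simp add: free_rel_def)
  qed
  moreover have "u \<in> ?c u" "v \<in> ?c v" using assms by (simp_all add: free_rel_def free_refl)
  ultimately have "(\<Union>u'\<in>?c u. \<Union>v'\<in>?c v. ?c (u' @ v')) = ?c (u @ v)" by blast
  then show ?thesis by (simp only: free_group_def monoid.simps)
qed

lemma free_group_is_group: "group (free_group X)"
proof (rule groupI)
  have car: "A \<in> carrier (free_group X) \<longleftrightarrow> (\<exists>u\<in>words X. A = free_rel X `` {u})" for A
    by (auto simp: free_group_def quotient_def)
  have one: "\<one>\<^bsub>free_group X\<^esub> = free_rel X `` {[]}" by (simp add: free_group_def)
  have nil: "[] \<in> words X" by (simp add: words_def)
  show "\<one>\<^bsub>free_group X\<^esub> \<in> carrier (free_group X)" unfolding car one using nil by blast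
  show "A \<otimes>\<^bsub>free_group X\<^esub> B \<in> carrier (free_group X)"
    if "A \<in> carrier (free_group X)" "B \<in> carrier (free_group X)" for A B
  proof -
    obtain u v where uv: "u \<in> words X" "A = free_rel X `` {u}" "v \<in> words X" "B = free_rel X `` {v}"
      using \<open>A \<in> _\<close> \<open>B \<in> _\<close> unfolding car by blast
    then have "A \<otimes>\<^bsub>free_group X\<^esub> B = free_rel X `` {u @ v}" "u @ v \<in> words X"
      by (simp_all add: free_group_mult words_append)
    then show ?thesis unfolding car by blast
  qed
  show "A \<otimes>\<^bsub>free_group X\<^esub> B \<otimes>\<^bsub>free_group X\<^esub> C = A \<otimes>\<^bsub>free_group X\<^esub> (B \<otimes>\<^bsub>free_group X\<^esub> C)"
    if "A \<in> carrier (free_group X)" "B \<in> carrier (free_group X)" "C \<in> carrier (free_group X)" for A B C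
  proof -
    obtain u v w where w: "u \<in> words X" "v \<in> words X" "w \<in> words X"
      and ABC: "A = free_rel X `` {u}" "B = free_rel X `` {v}" "C = free_rel X `` {w}"
      using \<open>A \<in> _\<close> \<open>B \<in> _\<close> \<open>C \<in> _\<close> unfolding car by blast
    show ?thesis
      unfolding ABC using w by (simp only: free_group_mult words_append append_assoc simp_thms)
  qed
  show "\<one>\<^bsub>free_group X\<^esub> \<otimes>\<^bsub>free_group X\<^esub> A = A" if "A \<in> carrier (free_group X)" for A
  proof -
    obtain u where u: "u \<in> words X" "A = free_rel X `` {u}"
      using \<open>A \<in> _\<close> unfolding car by blast
    show ?thesis unfolding one u(2) by (simp only: free_group_mult[OF nil u(1)] append_Nil)
  qed
  have inv: "\<exists>v\<in>words X. free_eq X (v @ u) []" if "u \<in> words X" for u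
    using that
  proof (induction u)
    case Nil
    then show ?case using nil free_refl[OF nil] by (intro bexI[of _ "[]"]) simp_all
  next
    case (Cons a u)
    obtain x b where a: "a = (x, b)" by (cases a)
    have xu: "x \<in> X" "u \<in> words X" using Cons.prems by (auto simp: words_def a)
    then obtain v where v: "v \<in> words X" "free_eq X (v @ u) []" using Cons.IH by blast
    have "free_eq X ((v @ [(x, \<not> b)]) @ a # u) (v @ u)"
      using free_cancel[OF v(1) xu(2,1), of "\<not> b"] by (simp add: a)
    then have "free_eq X ((v @ [(x, \<not> b)]) @ a # u) []" using v(2) by (rule free_trans)
    moreover have "v @ [(x, \<not> b)] \<in> words X" using v(1) xu(1) by (auto simp: words_def)
    ultimately show ?case by blast
  qed
  show "\<exists>B\<in>carrier (free_group X). B \<otimes>\<^bsub>free_group X\<^esub> A = \<one>\<^bsub>free_group X\<^esub>"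
    if A: "A \<in> carrier (free_group X)" for A
  proof -
    obtain u where u: "u \<in> words X" "A = free_rel X `` {u}" using A unfolding car by blast
    obtain v where v: "v \<in> words X" "free_eq X (v @ u) []" using inv u(1) by blast
    have "free_rel X `` {v @ u} = free_rel X `` {[]}"
      using v(2) equiv_class_eq[OF equiv_free_rel, of "v @ u" "[]" X] by (simp add: free_rel_def)
    then have "free_rel X `` {v} \<otimes>\<^bsub>free_group X\<^esub> A = \<one>\<^bsub>free_group X\<^esub>"
      by (simp only: u(2) one free_group_mult[OF v(1) u(1)])
    moreover have "free_rel X `` {v} \<in> carrier (free_group X)" using v(1) car by blast
    ultimately show ?thesis by blast
  qed
qed

lemma normal_closure_normal:
  fixes G (structure)
  assumes "group G" "A \<subseteq> carrier G"
  shows "normal_closure G A \<lhd> G"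
proof -
  interpret group G by fact
  have car: "carrier G \<lhd> G"
    unfolding normal_inv_iff by (simp add: subgroup_self)
  have sub: "subgroup (normal_closure G A) G"
    unfolding normal_closure_def
  proof (rule subgroups_Inter)
    show "{N. N \<lhd> G \<and> A \<subseteq> N} \<noteq> {}" using car assms(2) by blast
  qed (blast dest: normal_imp_subgroup)
  have conj: "x \<otimes> h \<otimes> inv x \<in> normal_closure G A"
    if "x \<in> carrier G" "h \<in> normal_closure G A" for x h
    unfolding normal_closure_def
  proof (rule InterI)
    fix N assume "N \<in> {N. N \<lhd> G \<and> A \<subseteq> N}"
    then have N: "N \<lhd> G" "h \<in> N" using that(2) by (simp_all add: normal_closure_def)
    then show "x \<otimes> h \<otimes> inv x \<in> N" using that(1) unfolding normal_inv_iff by blast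
  qed
  show ?thesis
    unfolding normal_inv_iff using sub conj by blast
qed

end

theory Submission
  imports Defs "HOL-Real_Asymp.Real_Asymp" "HOL-Library.Disjoint_Sets"
begin

text \<open>
  For a finite generating set \<open>T\<close> there are finite sets \<open>S \<supseteq> T\<close> and \<open>F\<close>
  such that a vertex of \<open>T F\<close> is determined by its neighbours in \<open>F\<close> in
  \<open>Cay G S\<close>: for finite \<open>G\<close> take \<open>F = G\<close> and the complete graph; for infinite
  \<open>G\<close> let \<open>F\<close> be a union of \<open>N\<close> disjoint translates of a fixed finite set and
  \<open>S\<close> a random symmetric subset of the quotients that occur. Two vertices are separated with a
  failure probability that is exponentially small in \<open>N\<close>, while the number of pairs is polynomial
  in \<open>N\<close>. Hence a local isomorphism defined on a large enough ball is determined on \<open>T F\<close>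
  by its germ, i.e. its restriction to \<open>F\<close>, and then along all short words.

  The finite sets of germs of self-isomorphisms of balls of radius \<open>n\<close> decrease with
  \<open>n\<close>, so for some \<open>R\<close> the radii \<open>R\<close> and \<open>R + 1\<close> give the same germs.
  If \<open>Y\<close> is \<open>(R + 1)\<close>-locally \<open>Cay G S\<close>, the letters of a presentation of
  \<open>G\<close> therefore act on the germs of charts \<open>Cay G S \<rightarrow> Y\<close> by translation.
  Relators are short, so they act trivially, and \<open>G\<close> itself acts. Following the base point of one
  germ under this action gives the covering map.
\<close>

section \<open>A random separating connection set\<close>

text \<open>The traces of a random subset of \<open>U\<close> on the disjoint blocks
  \<open>K w\<close> are independent, and one given trace on a block of at most three points is
  avoided with probability at most 7/8. Denominators are cleared so that the count stays in the
  natural numbers.\<close>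

lemma card_subsets_avoiding_traces:
  assumes "finite W" "finite U"
    and "\<And>w. w \<in> W \<Longrightarrow> K w \<subseteq> U \<and> card (K w) \<le> 3 \<and> a w \<subseteq> K w"
    and "disjoint_family_on K W"
  shows "8 ^ card W * card {C. C \<subseteq> U \<and> (\<forall>w\<in>W. C \<inter> K w \<noteq> a w)} \<le> 7 ^ card W * 2 ^ card U"
  using assms
proof (induction W arbitrary: U rule: finite_induct)
  case empty
  have "{C. C \<subseteq> U} = Pow U" by auto
  then show ?case using empty by (simp add: card_Pow)
next
  case (insert w W)
  define V where "V = U - K w"
  let ?good = "\<lambda>U W. {C. C \<subseteq> U \<and> (\<forall>w\<in>W. C \<inter> K w \<noteq> a w)}"
  have K: "K w \<subseteq> U" "card (K w) \<le> 3" "a w \<subseteq> K w" using insert.prems by auto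
  have disj: "K w \<inter> K w' = {}" if "w' \<in> W" for w'
    using insert.prems(3) insert.hyps(2) that by (auto simp: disjoint_family_on_def)
  have fin: "finite (K w)" "finite V" using K insert.prems(1) finite_subset by (auto simp: V_def)
  have KV: "K w' \<subseteq> V" if "w' \<in> W" for w'
    using disj[OF that] insert.prems(2) that by (force simp: V_def)
  have IH: "8 ^ card W * card (?good V W) \<le> 7 ^ card W * 2 ^ card V"
    using insert.prems fin KV by (intro insert.IH) (auto simp: disjoint_family_on_def)
  \<comment> \<open>Cutting \<open>C\<close> along the block \<open>K w\<close> makes the count a
    product: the trace on \<open>K w\<close> may be anything but \<open>a w\<close>, and the rest is
    counted by the induction hypothesis.\<close>
  have "bij_betw (\<lambda>C. (C \<inter> K w, C - K w)) (?good U (insert w W)) ((Pow (K w) - {a w}) \<times> ?good V W)"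
  proof (rule bij_betw_byWitness[where f' = "\<lambda>(A, B). A \<union> B"])
    show "(\<lambda>C. (C \<inter> K w, C - K w)) ` ?good U (insert w W) \<subseteq> (Pow (K w) - {a w}) \<times> ?good V W"
    proof -
      have "(C - K w) \<inter> K w' = C \<inter> K w'" if "w' \<in> W" for C w' using disj[OF that] by auto
      then show ?thesis by (auto simp: V_def)
    qed
    show "(\<lambda>(A, B). A \<union> B) ` ((Pow (K w) - {a w}) \<times> ?good V W) \<subseteq> ?good U (insert w W)"
    proof -
      have "(A \<union> B) \<inter> K w' = B \<inter> K w'" if "w' \<in> W" "A \<subseteq> K w" for A B w'
        using disj[OF that(1)] that(2) by auto
      moreover have "(A \<union> B) \<inter> K w = A" if "A \<subseteq> K w" "B \<subseteq> V" for A B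
        using that by (auto simp: V_def)
      ultimately show ?thesis using K(1) by (auto simp: V_def)
    qed
  qed (auto simp: V_def)
  then have "card (?good U (insert w W)) = card (Pow (K w) - {a w}) * card (?good V W)"
    by (simp add: bij_betw_same_card card_cartesian_product)
  also have "card (Pow (K w) - {a w}) = 2 ^ card (K w) - 1"
    using K fin by (simp add: card_Pow)
  finally have c: "card (?good U (insert w W)) = (2 ^ card (K w) - 1) * card (?good V W)" .
  have "(2::nat) ^ card (K w) \<le> 2 ^ 3" by (rule power_increasing) (use K in auto)
  then have k: "8 * (2 ^ card (K w) - 1) \<le> 7 * (2::nat) ^ card (K w)" by simp
  have U: "card U = card (K w) + card V"
    using K fin insert.prems(1) by (simp add: V_def card_Diff_subset card_mono)
  have "8 ^ card (insert w W) * card (?good U (insert w W))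
      = (8 * (2 ^ card (K w) - 1)) * (8 ^ card W * card (?good V W))"
    unfolding c using insert.hyps by simp
  also have "\<dots> \<le> (7 * 2 ^ card (K w)) * (7 ^ card W * 2 ^ card V)"
    by (rule mult_le_mono[OF k IH])
  also have "\<dots> = 7 ^ card (insert w W) * 2 ^ card U"
    using insert.hyps by (simp add: U power_add mult_ac)
  finally show ?case .
qed

text \<open>In a disjoint subfamily \<open>W\<close> of largest size, every \<open>K q\<close> meets
  some \<open>K w\<close> with \<open>w\<close> in \<open>W\<close>, since otherwise
  \<open>q\<close> could be added. So \<open>Q\<close> is covered by \<open>card W\<close> sets of
  at most \<open>m\<close> indices.\<close>

lemma large_disjoint_subfamily:
  assumes "finite Q" and ne: "\<And>w. w \<in> Q \<Longrightarrow> K w \<noteq> {}"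
    and few: "\<And>w. w \<in> Q \<Longrightarrow> card {w' \<in> Q. K w \<inter> K w' \<noteq> {}} \<le> m"
  shows "\<exists>W\<subseteq>Q. disjoint_family_on K W \<and> card Q \<le> m * card W"
proof -
  let ?P = "\<lambda>W. W \<subseteq> Q \<and> disjoint_family_on K W"
  have "?P {}" by (auto simp: disjoint_family_on_def)
  moreover have "\<forall>W. ?P W \<longrightarrow> card W < Suc (card Q)"
    using assms(1) by (simp add: card_mono less_Suc_eq_le)
  ultimately have "\<exists>W. ?P W \<and> (\<forall>W'. ?P W' \<longrightarrow> card W' \<le> card W)"
    by (rule ex_has_greatest_nat)
  then obtain W where W: "?P W" and max: "\<And>W'. ?P W' \<Longrightarrow> card W' \<le> card W"
    by auto
  have finW: "finite W" using W assms(1) finite_subset by blast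
  have "Q \<subseteq> (\<Union>w\<in>W. {w' \<in> Q. K w \<inter> K w' \<noteq> {}})"
  proof
    fix q assume q: "q \<in> Q"
    show "q \<in> (\<Union>w\<in>W. {w' \<in> Q. K w \<inter> K w' \<noteq> {}})"
    proof (rule ccontr)
      assume no: "\<not> ?thesis"
      then have "q \<notin> W" using ne q by auto
      have "?P (insert q W)"
        using no q W unfolding disjoint_family_on_def by (auto simp: Int_commute)
      then have "card (insert q W) \<le> card W" by (rule max)
      then show False using \<open>q \<notin> W\<close> finW by simp
    qed
  qed
  then have "card Q \<le> card (\<Union>w\<in>W. {w' \<in> Q. K w \<inter> K w' \<noteq> {}})"
    using finW assms(1) by (intro card_mono) auto
  also have "\<dots> \<le> (\<Sum>w\<in>W. card {w' \<in> Q. K w \<inter> K w' \<noteq> {}})" by (rule card_UN_le[OF finW])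
  also have "\<dots> \<le> (\<Sum>w\<in>W. m)" using W few by (intro sum_mono) auto
  finally show ?thesis using W by (auto simp: mult.commute)
qed

section \<open>Squares in a group, disjoint translates and the union bound\<close>

context group begin

lemma commutes_generate:
  assumes T: "T \<subseteq> carrier G" and c: "c \<in> carrier G" "\<And>t. t \<in> T \<Longrightarrow> c \<otimes> t = t \<otimes> c"
    and g: "g \<in> generate G T"
  shows "c \<otimes> g = g \<otimes> c"
  using g
proof induction
  case one
  then show ?case using c by simp
next
  case (incl t)
  then show ?case using c by simp
next
  case (inv t)
  then have t: "t \<in> carrier G" "c \<otimes> t = t \<otimes> c" using T c by auto
  have "c \<otimes> inv t = inv t \<otimes> (t \<otimes> c) \<otimes> inv t"
    using t(1) c(1) by (simp add: m_assoc[symmetric])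
  also have "\<dots> = inv t \<otimes> (c \<otimes> t) \<otimes> inv t" using t by simp
  also have "\<dots> = inv t \<otimes> c" using t(1) c(1) by (simp add: m_assoc)
  finally show ?case .
next
  case (eng a b)
  then have "a \<in> carrier G" "b \<in> carrier G" using generate_in_carrier[OF T] by blast+
  then have "c \<otimes> (a \<otimes> b) = c \<otimes> a \<otimes> b" "a \<otimes> b \<otimes> c = a \<otimes> (b \<otimes> c)"
    using c by (simp_all add: m_assoc)
  moreover have "a \<otimes> c \<otimes> b = a \<otimes> (c \<otimes> b)"
    using \<open>a \<in> carrier G\<close> \<open>b \<in> carrier G\<close> c by (simp add: m_assoc)
  ultimately show ?case using eng.IH by simp
qed

text \<open>Random membership of \<open>w\<close> and of \<open>inv v \<otimes> w\<close> in a symmetric set are tied together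
  exactly when \<open>w \<otimes> w = v\<close>. If this happened for all \<open>w \<otimes> d\<close>, then conjugation by
  \<open>w\<close> would invert every product of at most two generators, so \<open>G\<close> would be elementary abelian of
  exponent 2 and \<open>v = \<one>\<close>.\<close>

lemma exists_square_neq:
  assumes T: "T \<subseteq> carrier G" "generate G T = carrier G"
    and w: "w \<in> carrier G" and v: "v \<noteq> \<one>"
  shows "\<exists>d\<in>insert \<one> (T \<union> (T <#> T)). (w \<otimes> d) \<otimes> (w \<otimes> d) \<noteq> v"
proof (rule ccontr)
  assume "\<not> ?thesis"
  then have sq: "(w \<otimes> d) \<otimes> (w \<otimes> d) = v" if "d \<in> insert \<one> (T \<union> (T <#> T))" for d using that by blast
  have ww: "w \<otimes> w = v" using sq[of \<one>] w by simp
  have dwd: "d \<otimes> w \<otimes> d = w" if "d \<in> insert \<one> (T \<union> (T <#> T))" for d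
  proof -
    have d: "d \<in> carrier G" using that T by (auto simp: set_mult_def)
    have "w \<otimes> (d \<otimes> w \<otimes> d) = w \<otimes> w" using sq[OF that] ww d w by (simp add: m_assoc)
    then show ?thesis using d w by simp
  qed
  have twt: "t \<otimes> w \<otimes> t = w" if "t \<in> T" for t
    by (rule dwd) (use that in simp)
  \<comment> \<open>The case \<open>d = t \<otimes> s\<close> of \<open>dwd\<close> and
    \<open>twt\<close> for \<open>t\<close> both express \<open>w\<close>. Cancelling
    \<open>t\<close>, writing the remaining \<open>w\<close> as
    \<open>s \<otimes> w \<otimes> s\<close> and cancelling \<open>s \<otimes> w\<close> leaves the
    commutation.\<close>
  have comm: "s \<otimes> t = t \<otimes> s" if st: "s \<in> T" "t \<in> T" for s t
  proof -
    have c: "s \<in> carrier G" "t \<in> carrier G" using st T by auto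
    have "t \<otimes> s \<in> T <#> T" using st by (auto simp: set_mult_def)
    then have "t \<otimes> (s \<otimes> w \<otimes> t \<otimes> s) = w" using dwd[of "t \<otimes> s"] c w by (simp add: m_assoc)
    also have "\<dots> = t \<otimes> (w \<otimes> t)" using twt[OF st(2)] c w by (simp add: m_assoc)
    finally have "s \<otimes> w \<otimes> t \<otimes> s = w \<otimes> t" using c w by simp
    also have "\<dots> = (s \<otimes> w \<otimes> s) \<otimes> t" using twt[OF st(1)] by simp
    finally have "(s \<otimes> w) \<otimes> (t \<otimes> s) = (s \<otimes> w) \<otimes> (s \<otimes> t)" using c w by (simp add: m_assoc)
    then show ?thesis using c w by simp
  qed
  have comm1: "t \<otimes> g = g \<otimes> t" if "t \<in> T" "g \<in> carrier G" for t g
    using commutes_generate[OF T(1), of t g] comm that T by auto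
  have comm2: "h \<otimes> g = g \<otimes> h" if "h \<in> carrier G" "g \<in> carrier G" for h g
    using commutes_generate[OF T(1), of h g] comm1[of _ h] that T by metis
  have tt: "t \<otimes> t = \<one>" if "t \<in> T" for t
  proof -
    have t: "t \<in> carrier G" using that T by auto
    have "w \<otimes> (t \<otimes> t) = t \<otimes> w \<otimes> t" using t w comm1[OF that w] by (simp add: m_assoc)
    also have "\<dots> = w" using twt that by simp
    finally show ?thesis using t w by simp
  qed
  have "g \<otimes> g = \<one>" if "g \<in> generate G T" for g
    using that
  proof induction
    case (inv t)
    then have "inv t = t" using tt T by (intro inv_equality) auto
    then show ?case using tt inv by simp
  next
    case (eng a b)
    then have ab: "a \<in> carrier G" "b \<in> carrier G" using T by auto
    have "a \<otimes> b \<otimes> (a \<otimes> b) = a \<otimes> (b \<otimes> a) \<otimes> b" using ab by (simp add: m_assoc)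
    also have "\<dots> = (a \<otimes> a) \<otimes> (b \<otimes> b)" using ab by (simp add: comm2[of b a] m_assoc)
    finally show ?case using eng by simp
  qed (use tt in auto)
  then have "w \<otimes> w = \<one>" using w T by auto
  then show False using ww v by simp
qed

lemma exists_disjoint_translates:
  assumes "infinite (carrier G)" "finite D" "D \<subseteq> carrier G"
  shows "\<exists>A\<subseteq>carrier G. finite A \<and> card A = N \<and> disjoint_family_on (\<lambda>a. (\<otimes>) a ` D) A"
proof (induction N)
  case 0
  show ?case by (rule exI[of _ "{}"]) (auto simp: disjoint_family_on_def)
next
  case (Suc N)
  then obtain A where A: "A \<subseteq> carrier G" "finite A" "card A = N"
    "disjoint_family_on (\<lambda>a. (\<otimes>) a ` D) A" by blast
  \<comment> \<open>The translates of \<open>D\<close> by \<open>a\<close> and \<open>b\<close> meet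
    only if \<open>b\<close> has the form \<open>a \<otimes> d \<otimes> inv e\<close>. Avoiding
    \<open>A\<close> itself makes the cardinality grow.\<close>
  let ?X = "(\<lambda>(a, d, e). a \<otimes> d \<otimes> inv e) ` (A \<times> D \<times> D) \<union> A"
  have "finite ?X" using A assms by auto
  then have "\<not> carrier G \<subseteq> ?X" using assms(1) finite_subset by metis
  then obtain b where b: "b \<in> carrier G" "b \<notin> (\<lambda>(a, d, e). a \<otimes> d \<otimes> inv e) ` (A \<times> D \<times> D)" "b \<notin> A"
    by blast
  have disj: "(\<otimes>) a ` D \<inter> (\<otimes>) b ` D = {}" if a: "a \<in> A" for a
  proof (rule ccontr)
    assume "\<not> ?thesis"
    then obtain d e where de: "d \<in> D" "e \<in> D" "a \<otimes> d = b \<otimes> e" by auto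
    then have "b = a \<otimes> d \<otimes> inv e" using a A(1) b(1) assms(3)
      by (metis inv_solve_right m_closed subsetD)
    then show False using b(2) a de by force
  qed
  show ?case
  proof (intro exI[of _ "insert b A"] conjI)
    show "disjoint_family_on (\<lambda>a. (\<otimes>) a ` D) (insert b A)"
      using A(4) b(3) disj by (subst disjoint_family_on_insert) blast+
  qed (use A b in auto)
qed

text \<open>\<open>C\<close> plays the role of a uniformly random subset of \<open>U\<close>.
  Keeping \<open>w\<close> only together with its inverse makes the result symmetric when
  \<open>U\<close> and \<open>T\<close> are, and \<open>T\<close> is forced in so that the set still
  generates.\<close>

definition randomized_connection_set where
  "randomized_connection_set U T C = {w \<in> U. w \<in> C \<and> inv w \<in> C \<and> w \<noteq> \<one>} \<union> (T - {\<one>})"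

text \<open>With \<open>w = inv x \<otimes> y\<close>, the vertex \<open>x'\<close> sees
  \<open>y\<close> through \<open>inv v \<otimes> w\<close>. If \<open>C\<close> contains
  \<open>w\<close> and its inverse but not \<open>inv v \<otimes> w\<close>, then \<open>y\<close>
  separates \<open>x\<close> from \<open>x'\<close>, apart from the exceptional \<open>w\<close>
  removed in \<open>Q\<close>. Each translate given by \<open>A\<close> supplies one candidate
  \<open>w\<close>. The exceptions cost at most \<open>card T + 1\<close> candidates, and passing to
  independent events costs the factor 9.\<close>

lemma card_nonseparating:
  assumes T: "T \<subseteq> carrier G" "generate G T = carrier G" "finite T"
    and U: "U \<subseteq> carrier G" "finite U" "\<And>w. w \<in> U \<Longrightarrow> inv w \<in> U"
    and A: "A \<subseteq> carrier G" "finite A"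
      "disjoint_family_on (\<lambda>a. (\<otimes>) a ` insert \<one> (T \<union> (T <#> T))) A"
    and F: "\<And>a d. a \<in> A \<Longrightarrow> d \<in> insert \<one> (T \<union> (T <#> T)) \<Longrightarrow> a \<otimes> d \<in> F" "F \<subseteq> carrier G"
    and x: "x \<in> carrier G" "x' \<in> carrier G" "x \<noteq> x'" "\<And>y. y \<in> F \<Longrightarrow> inv x \<otimes> y \<in> U"
  shows "real (card {C. C \<subseteq> U \<and> (\<forall>y\<in>F. inv x \<otimes> y \<in> randomized_connection_set U T C \<longrightarrow>
      inv x' \<otimes> y \<in> randomized_connection_set U T C)})
    \<le> 2 ^ card U * (7 / 8) powr ((real (card A) - (real (card T) + 1)) / 9)"
proof -
  define v where "v = inv x \<otimes> x'"
  have v: "v \<in> carrier G" "v \<noteq> \<one>" using x(1-3)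
    by (auto simp: v_def inv_solve_left')
  let ?D = "insert \<one> (T \<union> (T <#> T))"
  let ?S = "randomized_connection_set U T"
  \<comment> \<open>\<open>K w\<close> collects the points of \<open>U\<close> that matter for the
    event at \<open>w\<close>. The inverse of \<open>inv v \<otimes> w\<close> is left out because
    absence of \<open>inv v \<otimes> w\<close> from \<open>C\<close> alone already keeps it out of
    the random part.\<close>
  define K where "K w = {w, inv w, inv v \<otimes> w} \<inter> U" for w
  have Dc: "?D \<subseteq> carrier G" using T by (auto simp: set_mult_def)
  have "\<forall>a\<in>A. \<exists>d. d \<in> ?D \<and> (inv x \<otimes> a \<otimes> d) \<otimes> (inv x \<otimes> a \<otimes> d) \<noteq> v"
    using exists_square_neq[OF T(1,2) _ v(2)] A(1) x(1) by blast
  then obtain \<delta> where \<delta>: "\<And>a. a \<in> A \<Longrightarrow> \<delta> a \<in> ?D"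
    "\<And>a. a \<in> A \<Longrightarrow> (inv x \<otimes> a \<otimes> \<delta> a) \<otimes> (inv x \<otimes> a \<otimes> \<delta> a) \<noteq> v"
    by metis
  define q where "q a = inv x \<otimes> (a \<otimes> \<delta> a)" for a
  have inj: "inj_on q A"
  proof (rule inj_onI)
    fix a b assume ab: "a \<in> A" "b \<in> A" "q a = q b"
    have "a \<in> carrier G" "b \<in> carrier G" "\<delta> a \<in> carrier G" "\<delta> b \<in> carrier G"
      using ab A(1) \<delta>(1) Dc by blast+
    then have "a \<otimes> \<delta> a = b \<otimes> \<delta> b" using ab(3) x(1) by (simp add: q_def)
    then have "(\<otimes>) a ` ?D \<inter> (\<otimes>) b ` ?D \<noteq> {}" using \<delta>(1)[OF ab(1)] \<delta>(1)[OF ab(2)] by blast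
    then show "a = b" using A(3) ab(1,2) unfolding disjoint_family_on_def by blast
  qed
  \<comment> \<open>Removed are \<open>\<one>\<close>, which is never in the connection set, and the
    \<open>w\<close> with \<open>inv v \<otimes> w\<close> in \<open>T\<close>, for which that
    element may be present whatever \<open>C\<close> is.\<close>
  define Q where "Q = q ` A - (insert \<one> ((\<otimes>) v ` T))"
  have qU: "q a \<in> U" if "a \<in> A" for a
    unfolding q_def using x(4) F(1) \<delta>(1) that by blast
  have Q: "Q \<subseteq> U" "finite Q" using qU A(2) by (auto simp: Q_def)
  have Qc: "w \<in> carrier G" if "w \<in> Q" for w using Q that U by auto
  have QF: "x \<otimes> w \<in> F" if w: "w \<in> Q" for w
  proof -
    obtain a where a: "a \<in> A" "w = q a" using w by (auto simp: Q_def)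
    have "a \<otimes> \<delta> a \<in> F" using F(1) a \<delta>(1) by blast
    moreover have "x \<otimes> q a = a \<otimes> \<delta> a" using calculation x(1) F(2)
      by (simp add: q_def m_assoc[symmetric] subset_iff)
    ultimately show ?thesis using a by simp
  qed
  have sq: "w \<otimes> w \<noteq> v" if w: "w \<in> Q" for w
  proof -
    obtain a where a: "a \<in> A" "w = q a" using w by (auto simp: Q_def)
    have "w = inv x \<otimes> a \<otimes> \<delta> a" using a A(1) \<delta>(1) Dc x(1)
      by (metis inv_closed m_assoc q_def subsetD)
    then show ?thesis using \<delta>(2) a by simp
  qed
  have "card A \<le> card Q + card (insert \<one> ((\<otimes>) v ` T))"
    using diff_card_le_card_Diff[of "insert \<one> ((\<otimes>) v ` T)" "q ` A"] T(3)
    by (simp add: Q_def card_image[OF inj] le_diff_conv)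
  also have "card (insert \<one> ((\<otimes>) v ` T)) \<le> card T + 1"
    using card_image_le[OF T(3), of "(\<otimes>) v"] card_insert_le_m1[of "card T + 1"]
    by (simp add: card_insert_if T(3))
  finally have cQ: "card A \<le> card Q + card T + 1" by simp
  \<comment> \<open>On a subfamily \<open>W\<close> with disjoint \<open>K w\<close> the failures are independent, and each one
    excludes a trace on at most three points.\<close>
  have "\<exists>W\<subseteq>Q. disjoint_family_on K W \<and> card Q \<le> 9 * card W"
  proof (rule large_disjoint_subfamily[OF Q(2)])
    show "K w \<noteq> {}" if "w \<in> Q" for w using that Q by (auto simp: K_def)
    show "card {w' \<in> Q. K w \<inter> K w' \<noteq> {}} \<le> 9" if w: "w \<in> Q" for w
    proof -
      \<comment> \<open>A common point \<open>k\<close> of \<open>K w\<close> and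
        \<open>K w'\<close> is one of three values, and each value leaves three possibilities for
        \<open>w'\<close>.\<close>
      let ?k = "[w, inv w, inv v \<otimes> w]"
      let ?l = "concat (map (\<lambda>k. [k, inv k, v \<otimes> k]) ?k)"
      have "{w' \<in> Q. K w \<inter> K w' \<noteq> {}} \<subseteq> set ?l"
      proof
        fix w' assume "w' \<in> {w' \<in> Q. K w \<inter> K w' \<noteq> {}}"
        then obtain k where w': "w' \<in> Q" and k: "k \<in> set ?k" "k \<in> {w', inv w', inv v \<otimes> w'}"
          by (auto simp: K_def)
        have "w' \<in> {k, inv k, v \<otimes> k}"
          using k(2) Qc[OF w'] v by (auto simp: m_assoc[symmetric])
        then show "w' \<in> set ?l" using k(1) by auto
      qed
      then have "card {w' \<in> Q. K w \<inter> K w' \<noteq> {}} \<le> card (set ?l)" by (intro card_mono) auto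
      also have "\<dots> \<le> length ?l" by (rule card_length)
      finally show ?thesis by simp
    qed
  qed
  then obtain W where W: "W \<subseteq> Q" "disjoint_family_on K W" "card Q \<le> 9 * card W" by blast
  let ?bad = "{C. C \<subseteq> U \<and> (\<forall>y\<in>F. inv x \<otimes> y \<in> ?S C \<longrightarrow> inv x' \<otimes> y \<in> ?S C)}"
  let ?bad' = "{C. C \<subseteq> U \<and> (\<forall>w\<in>W. C \<inter> K w \<noteq> {w, inv w})}"
  have "?bad \<subseteq> ?bad'"
  proof (safe)
    fix C w assume C: "C \<subseteq> U" "\<forall>y\<in>F. inv x \<otimes> y \<in> ?S C \<longrightarrow> inv x' \<otimes> y \<in> ?S C"
      and w: "w \<in> W" "C \<inter> K w = {w, inv w}"
    have wQ: "w \<in> Q" and wc: "w \<in> carrier G" using w W Qc by auto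
    have "w \<in> ?S C" using w wQ Q by (auto simp: randomized_connection_set_def Q_def)
    moreover have "inv x \<otimes> (x \<otimes> w) = w" using wc x(1) by (simp add: m_assoc[symmetric])
    ultimately have "inv x' \<otimes> (x \<otimes> w) \<in> ?S C" using C(2) QF[OF wQ] by auto
    moreover have "inv x' \<otimes> (x \<otimes> w) = inv v \<otimes> w"
      using wc x by (simp add: v_def inv_mult_group m_assoc)
    ultimately have "inv v \<otimes> w \<in> ?S C" by simp
    moreover have "inv v \<otimes> w \<notin> T"
    proof
      assume "inv v \<otimes> w \<in> T"
      moreover have "w = v \<otimes> (inv v \<otimes> w)" using wc v by (simp add: m_assoc[symmetric])
      ultimately show False using wQ by (auto simp: Q_def)
    qed
    ultimately have "inv v \<otimes> w \<in> C \<inter> K w"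
      by (auto simp: randomized_connection_set_def K_def)
    then have "inv v \<otimes> w = w \<or> inv v \<otimes> w = inv w" using w by simp
    then show False
    proof
      assume "inv v \<otimes> w = w"
      then have "inv v = \<one>" using wc v by simp
      then show False using v by simp
    next
      assume eq: "inv v \<otimes> w = inv w"
      have "w \<otimes> w = v \<otimes> (inv v \<otimes> w) \<otimes> w" using wc v(1) by (simp add: m_assoc[symmetric])
      also have "\<dots> = v" using wc v(1) by (simp add: eq m_assoc)
      finally have "w \<otimes> w = v" .
      then show False using sq wQ by simp
    qed
  qed
  then have "card ?bad \<le> card ?bad'" using U(2) by (intro card_mono) auto
  then have "8 ^ card W * card ?bad \<le> 8 ^ card W * card ?bad'" by simp
  also have "\<dots> \<le> 7 ^ card W * 2 ^ card U"
  proof (rule card_subsets_avoiding_traces)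
    show "finite W" using W(1) Q(2) finite_subset by blast
    show "K w \<subseteq> U \<and> card (K w) \<le> 3 \<and> {w, inv w} \<subseteq> K w" if "w \<in> W" for w
    proof -
      have "card (K w) \<le> card (set [w, inv w, inv v \<otimes> w])"
        by (rule card_mono) (auto simp: K_def)
      also have "\<dots> \<le> 3" using card_length[of "[w, inv w, inv v \<otimes> w]"] by simp
      finally show ?thesis using that W Q U(3) by (auto simp: K_def)
    qed
  qed (use U W in auto)
  finally have "real (8 ^ card W * card ?bad) \<le> real (7 ^ card W * 2 ^ card U)" by (rule of_nat_mono)
  then have "real (card ?bad) \<le> 2 ^ card U * (7 / 8) ^ card W"
    by (simp add: power_divide field_simps)
  also have "(7 / 8 :: real) ^ card W = (7 / 8) powr real (card W)" by (simp add: powr_realpow)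
  also have "\<dots> \<le> (7 / 8) powr ((real (card A) - (real (card T) + 1)) / 9)"
    by (rule powr_mono') (use cQ W(3) in auto)
  finally show ?thesis by simp
qed

text \<open>The condition is one-sided: already an inclusion of the neighbourhoods within
  \<open>F\<close> forces equality. This is stronger than saying that distinct vertices have
  distinct neighbourhoods there, and it also excludes \<open>x'\<close> far from
  \<open>F\<close>.\<close>

definition separating_set where
  "separating_set S T F \<longleftrightarrow> (\<forall>t\<in>T. \<forall>h\<in>F. \<forall>x'\<in>carrier G.
     (\<forall>y\<in>F. inv (t \<otimes> h) \<otimes> y \<in> S \<longrightarrow> inv x' \<otimes> y \<in> S) \<longrightarrow> x' = t \<otimes> h)"

lemma card_translates_le:
  assumes "finite A" "finite T"
  shows "finite (A <#> insert \<one> (T \<union> (T <#> T)))"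
    and "card (A <#> insert \<one> (T \<union> (T <#> T))) \<le> card A * (1 + card T + card T * card T)"
proof -
  have TT: "T <#> T = (\<lambda>(s, t). s \<otimes> t) ` (T \<times> T)" by (auto simp: set_mult_def)
  have A: "A <#> D = (\<lambda>(s, t). s \<otimes> t) ` (A \<times> D)" for D by (auto simp: set_mult_def)
  have "finite (T <#> T)" unfolding TT using assms by auto
  then show "finite (A <#> insert \<one> (T \<union> (T <#> T)))" unfolding A using assms by auto
  have "card (T <#> T) \<le> card T * card T"
    unfolding TT using card_image_le[of "T \<times> T"] assms by (simp add: card_cartesian_product)
  moreover have "card (T \<union> (T <#> T)) \<le> card T + card (T <#> T)" by (rule card_Un_le)
  moreover have "card (insert \<one> (T \<union> (T <#> T))) \<le> Suc (card (T \<union> (T <#> T)))"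
    by (rule card_insert_le_m1) auto
  ultimately have "card (insert \<one> (T \<union> (T <#> T))) \<le> 1 + card T + card T * card T" by linarith
  then have "card A * card (insert \<one> (T \<union> (T <#> T))) \<le> card A * (1 + card T + card T * card T)"
    by (rule mult_le_mono2)
  moreover have "card (A <#> insert \<one> (T \<union> (T <#> T))) \<le> card A * card (insert \<one> (T \<union> (T <#> T)))"
    unfolding A using card_image_le[of "A \<times> insert \<one> (T \<union> (T <#> T))"] assms \<open>finite (T <#> T)\<close>
    by (simp add: card_cartesian_product)
  ultimately show "card (A <#> insert \<one> (T \<union> (T <#> T))) \<le> card A * (1 + card T + card T * card T)"
    by linarith
qed

lemma exists_separating_set_infinite:
  assumes inf: "infinite (carrier G)"
    and T: "finite T" "T \<subseteq> carrier G" "m_inv G ` T = T" "generate G T = carrier G"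
  shows "\<exists>S F. finite S \<and> S \<subseteq> carrier G - {\<one>} \<and> m_inv G ` S = S \<and> T - {\<one>} \<subseteq> S \<and>
    finite F \<and> F \<subseteq> carrier G \<and> \<one> \<in> F \<and> separating_set S T F"
proof -
  let ?D = "insert \<one> (T \<union> (T <#> T))"
  define c :: real where "c = real (card T) + 1"
  define d :: real where "d = 1 + card T + real (card T) * card T"
  have cd: "c > 0" "d > 0" by (auto simp: c_def d_def add_pos_nonneg)
  define f :: "nat \<Rightarrow> real" where "f N = real N * d + 1" for N
  \<comment> \<open>Here \<open>f N\<close> will bound \<open>card F\<close>. The first factor
    bounds the number of \<open>x\<close>, the second the number of relevant \<open>x'\<close>, and
    the last is the failure rate of one pair. A product below 1 lets the union bound leave a good
    \<open>C\<close>.\<close>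
  have "((\<lambda>N::nat. (c * f N) * (f N * (2 * c * f N ^ 2 + c)) * (7 / 8) powr ((real N - c) / 9))
      \<longlongrightarrow> 0) at_top"
    unfolding f_def using cd by real_asymp
  then have "eventually (\<lambda>N::nat. (c * f N) * (f N * (2 * c * f N ^ 2 + c)) * (7 / 8) powr ((real N - c) / 9) < 1) at_top"
    by (rule order_tendstoD) simp
  \<comment> \<open>\<open>N \<ge> 2\<close> gives \<open>F\<close> at least two points, which is
    used at the end to find a neighbour in \<open>F\<close> of each vertex of
    \<open>X\<close>.\<close>
  then have "eventually (\<lambda>N::nat. (c * f N) * (f N * (2 * c * f N ^ 2 + c)) * (7 / 8) powr ((real N - c) / 9) < 1 \<and> N \<ge> 2) at_top"
    using eventually_ge_at_top[of 2] by (rule eventually_conj)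
  then obtain N :: nat where N: "N \<ge> 2"
    "(c * f N) * (f N * (2 * c * f N ^ 2 + c)) * (7 / 8) powr ((real N - c) / 9) < 1"
    by (auto dest: eventually_happens)
  have Dc: "?D \<subseteq> carrier G" using T by (auto simp: set_mult_def)
  have "finite (T <#> T)" using T(1) by (auto simp: set_mult_def)
  then have Df: "finite ?D" using T(1) by simp
  obtain A where A: "A \<subseteq> carrier G" "finite A" "card A = N"
    "disjoint_family_on (\<lambda>a. (\<otimes>) a ` ?D) A"
    using exists_disjoint_translates[OF inf Df Dc] by blast
  \<comment> \<open>\<open>\<one>\<close> is added so that the restriction of a map to
    \<open>F\<close> also records its base point.\<close>
  define F where "F = insert \<one> (A <#> ?D)"
  have Fc: "F \<subseteq> carrier G" using A(1) Dc set_mult_closed by (auto simp: F_def)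
  have Ff: "finite F" using card_translates_le(1)[OF A(2) T(1)] by (simp add: F_def)
  have AF: "a \<otimes> e \<in> F" if "a \<in> A" "e \<in> ?D" for a e
    using that by (auto simp: F_def set_mult_def)
  have "A \<subseteq> F" using AF[of _ \<one>] A(1) by force
  have F2: "card F \<ge> 2"
    using card_mono[OF Ff \<open>A \<subseteq> F\<close>] A(3) N(1) by simp
  have cF: "real (card F) \<le> f N"
  proof -
    have "card F \<le> card (A <#> ?D) + 1"
      using card_translates_le(1)[OF A(2) T(1)] by (simp add: F_def card_insert_if)
    also have "\<dots> \<le> N * (1 + card T + card T * card T) + 1"
      using card_translates_le(2)[OF A(2) T(1)] A(3) by simp
    finally have "real (card F) \<le> real (N * (1 + card T + card T * card T) + 1)" by (rule of_nat_mono)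
    then show ?thesis by (simp add: f_def d_def algebra_simps)
  qed
  \<comment> \<open>These are the quotients that decide adjacency between \<open>T F\<close> and
    \<open>F\<close>. \<open>U\<close> closes them under inverses.\<close>
  define P where "P = (\<lambda>(t, h, y). inv (t \<otimes> h) \<otimes> y) ` (T \<times> F \<times> F)"
  define U where "U = P \<union> m_inv G ` P"
  have Pc: "P \<subseteq> carrier G"
    unfolding P_def using subsetD[OF T(2)] subsetD[OF Fc] by auto
  have Uc: "U \<subseteq> carrier G" using Pc by (auto simp: U_def)
  have Uf: "finite U" using T(1) Ff by (auto simp: U_def P_def)
  have Ui: "inv w \<in> U" if "w \<in> U" for w using that Pc by (auto simp: U_def)
  have cU: "real (card U) \<le> 2 * c * f N ^ 2"
  proof -
    have fP: "finite P" using T(1) Ff by (auto simp: P_def)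
    have "card P \<le> card T * (card F * card F)"
      unfolding P_def using card_image_le[of "T \<times> F \<times> F"] T(1) Ff
      by (simp add: card_cartesian_product)
    moreover have "card U \<le> card P + card P"
      using card_Un_le[of P "m_inv G ` P"] card_image_le[OF fP, of "m_inv G"] by (simp add: U_def)
    ultimately have "card U \<le> 2 * (card T * (card F * card F))" by linarith
    then have "real (card U) \<le> real (2 * (card T * (card F * card F)))" by (rule of_nat_mono)
    also have "\<dots> = 2 * (real (card T) * (real (card F) * real (card F)))" by simp
    also have "\<dots> \<le> 2 * (c * (f N * f N))"
      by (intro mult_mono cF) (use cF in \<open>auto simp: c_def f_def intro!: add_nonneg_nonneg mult_nonneg_nonneg less_imp_le[OF cd(2)]\<close>)
    finally show ?thesis by (simp add: power2_eq_square)
  qed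
  \<comment> \<open>Only \<open>x' \<in> V\<close> can have a neighbour in \<open>F\<close>, so finitely many pairs matter.\<close>
  define V where "V = F \<union> (\<lambda>(y, w). y \<otimes> w) ` (F \<times> (U \<union> T))"
  define X where "X = (\<lambda>(t, h). t \<otimes> h) ` (T \<times> F)"
  have Vf: "finite V" and Xf: "finite X" using Ff Uf T(1) by (auto simp: V_def X_def)
  have Vc: "V \<subseteq> carrier G" and Xc: "X \<subseteq> carrier G" using Fc Uc T(2) by (auto simp: V_def X_def)
  have cX: "real (card X) \<le> c * f N"
  proof -
    have "card X \<le> card T * card F"
      unfolding X_def using card_image_le[of "T \<times> F"] T(1) Ff by (simp add: card_cartesian_product)
    then have "real (card X) \<le> real (card T * card F)" by (rule of_nat_mono)
    also have "\<dots> \<le> c * f N" using mult_mono[of "real (card T)" c, OF _ cF] by (simp add: c_def)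
    finally show ?thesis .
  qed
  have cV: "real (card V) \<le> f N * (2 * c * f N ^ 2 + c)"
  proof -
    have "card ((\<lambda>(y, w). y \<otimes> w) ` (F \<times> (U \<union> T))) \<le> card F * card (U \<union> T)"
      using card_image_le[of "F \<times> (U \<union> T)"] T(1) Ff Uf by (simp add: card_cartesian_product)
    also have "\<dots> \<le> card F * (card U + card T)" by (intro mult_le_mono2 card_Un_le)
    finally have "card V \<le> card F + card F * (card U + card T)"
      using card_Un_le[of F "(\<lambda>(y, w). y \<otimes> w) ` (F \<times> (U \<union> T))"] by (simp add: V_def)
    then have "real (card V) \<le> real (card F + card F * (card U + card T))" by (rule of_nat_mono)
    also have "\<dots> = real (card F) * (real (card U) + c)" by (simp add: c_def algebra_simps)
    also have "\<dots> \<le> f N * (2 * c * f N ^ 2 + c)"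
      by (intro mult_mono cF add_mono cU) (use cF cd in auto)
    finally show ?thesis .
  qed
  let ?S = "randomized_connection_set U T"
  define bad where "bad x x' = {C. C \<subseteq> U \<and> (\<forall>y\<in>F. inv x \<otimes> y \<in> ?S C \<longrightarrow> inv x' \<otimes> y \<in> ?S C)}" for x x'
  have cbad: "real (card (bad x x')) \<le> 2 ^ card U * (7 / 8) powr ((real N - c) / 9)"
    if xx': "x \<in> X" "x' \<in> V" "x \<noteq> x'" for x x'
  proof -
    have "inv x \<otimes> y \<in> U" if "y \<in> F" for y using xx'(1) that by (force simp: X_def U_def P_def)
    then show ?thesis
      using card_nonseparating[OF T(2,4,1) Uc Uf Ui A(1,2,4) AF Fc, of x x'] xx' Xc Vc A(3)
      by (auto simp: bad_def c_def subset_iff)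
  qed
  define I where "I = {(x, x'). x \<in> X \<and> x' \<in> V \<and> x \<noteq> x'}"
  have I: "I \<subseteq> X \<times> V" "finite I" using finite_subset[of I "X \<times> V"] Xf Vf by (auto simp: I_def)
  have "card I \<le> card X * card V"
    using card_mono[OF _ I(1)] Xf Vf by (simp add: card_cartesian_product)
  then have "real (card I) \<le> real (card X * card V)" by (rule of_nat_mono)
  also have "\<dots> \<le> (c * f N) * (f N * (2 * c * f N ^ 2 + c))"
    using mult_mono[OF cX cV] cX by simp
  finally have cI: "real (card I) \<le> (c * f N) * (f N * (2 * c * f N ^ 2 + c))" .
  have "real (card (\<Union>(x, x')\<in>I. bad x x')) \<le> real (\<Sum>i\<in>I. card (case i of (x, x') \<Rightarrow> bad x x'))"
    by (intro of_nat_mono card_UN_le I)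
  also have "\<dots> = (\<Sum>i\<in>I. real (card (case i of (x, x') \<Rightarrow> bad x x')))" by simp
  also have "\<dots> \<le> (\<Sum>i\<in>I. 2 ^ card U * (7 / 8) powr ((real N - c) / 9))"
    by (intro sum_mono) (use cbad in \<open>auto simp: I_def\<close>)
  also have "\<dots> = real (card I) * (7 / 8) powr ((real N - c) / 9) * 2 ^ card U" by simp
  also have "\<dots> < 1 * 2 ^ card U"
  proof (rule mult_strict_right_mono)
    have "real (card I) * (7 / 8) powr ((real N - c) / 9)
        \<le> (c * f N) * (f N * (2 * c * f N ^ 2 + c)) * (7 / 8) powr ((real N - c) / 9)"
      by (rule mult_right_mono[OF cI]) simp
    then show "real (card I) * (7 / 8) powr ((real N - c) / 9) < 1" using N(2) by linarith
  qed simp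
  also have "\<dots> = real (card (Pow U))" using Uf by (simp add: card_Pow)
  finally have less: "card (\<Union>(x, x')\<in>I. bad x x') < card (Pow U)" by simp
  have "\<not> Pow U \<subseteq> (\<Union>(x, x')\<in>I. bad x x')"
  proof
    assume "Pow U \<subseteq> (\<Union>(x, x')\<in>I. bad x x')"
    moreover have "finite (\<Union>(x, x')\<in>I. bad x x')"
      using I(2) Uf by (auto simp: bad_def)
    ultimately show False using less card_mono by (metis not_le)
  qed
  then obtain C where C: "C \<subseteq> U" "\<And>x x'. x \<in> X \<Longrightarrow> x' \<in> V \<Longrightarrow> x \<noteq> x' \<Longrightarrow> C \<notin> bad x x'"
    by (force simp: I_def)
  have good: "\<exists>y\<in>F. inv x \<otimes> y \<in> ?S C \<and> inv x' \<otimes> y \<notin> ?S C"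
    if "x \<in> X" "x' \<in> V" "x \<noteq> x'" for x x'
    using C(2)[OF that] C(1) by (auto simp: bad_def)
  have Ssub: "?S C \<subseteq> U \<union> T" by (auto simp: randomized_connection_set_def)
  have Sinv: "inv s \<in> ?S C" if s: "s \<in> ?S C" for s
  proof -
    have sc: "s \<in> carrier G" using s Ssub Uc T(2) by blast
    show ?thesis
      using s
    proof (unfold randomized_connection_set_def, elim UnE)
      assume "s \<in> {w \<in> U. w \<in> C \<and> inv w \<in> C \<and> w \<noteq> \<one>}"
      then show "inv s \<in> {w \<in> U. w \<in> C \<and> inv w \<in> C \<and> w \<noteq> \<one>} \<union> (T - {\<one>})"
        using Ui sc by auto
    next
      assume "s \<in> T - {\<one>}"
      then show "inv s \<in> {w \<in> U. w \<in> C \<and> inv w \<in> C \<and> w \<noteq> \<one>} \<union> (T - {\<one>})"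
        using T(3) sc by auto
    qed
  qed
  have "separating_set (?S C) T F"
    unfolding separating_set_def
  proof (intro ballI impI)
    fix t h x' assume th: "t \<in> T" "h \<in> F" and x': "x' \<in> carrier G"
      and *: "\<forall>y\<in>F. inv (t \<otimes> h) \<otimes> y \<in> ?S C \<longrightarrow> inv x' \<otimes> y \<in> ?S C"
    have xX: "t \<otimes> h \<in> X" using th by (auto simp: X_def)
    \<comment> \<open>Some vertex of \<open>V\<close> differs from \<open>t \<otimes> h\<close>, so
      \<open>good\<close> provides a neighbour \<open>y\<close> of \<open>t \<otimes> h\<close> in
      \<open>F\<close>. By the assumed inclusion \<open>y\<close> is also adjacent to
      \<open>x'\<close>, which puts \<open>x'\<close> into \<open>V\<close>, where
      \<open>good\<close> applies to it.\<close>
    have "\<not> F \<subseteq> {t \<otimes> h}" using F2 card_mono[of "{t \<otimes> h}" F] by auto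
    then obtain z where "z \<in> V" "z \<noteq> t \<otimes> h" by (auto simp: V_def)
    then obtain y where y: "y \<in> F" "inv (t \<otimes> h) \<otimes> y \<in> ?S C" using good[OF xX] by metis
    then have s: "inv x' \<otimes> y \<in> ?S C" using * by auto
    have yc: "y \<in> carrier G" using y Fc by auto
    have "x' = y \<otimes> inv (inv x' \<otimes> y)"
      using x' yc by (simp add: inv_mult_group m_assoc[symmetric])
    moreover have "inv (inv x' \<otimes> y) \<in> U \<union> T" using Sinv[OF s] Ssub by blast
    ultimately have "x' \<in> V" using y by (force simp: V_def)
    then show "x' = t \<otimes> h" using good[OF xX, of x'] * by metis
  qed
  moreover have "m_inv G ` ?S C = ?S C"
  proof
    show "m_inv G ` ?S C \<subseteq> ?S C" using Sinv by auto
    show "?S C \<subseteq> m_inv G ` ?S C"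
    proof
      fix s assume s: "s \<in> ?S C"
      then have "s \<in> carrier G" using Ssub Uc T(2) by blast
      then show "s \<in> m_inv G ` ?S C" using Sinv[OF s] by (metis image_eqI inv_inv)
    qed
  qed
  moreover have "finite (?S C)" using Ssub Uf T(1) finite_subset by blast
  moreover have "?S C \<subseteq> carrier G - {\<one>}"
    using Uc T(2) by (auto simp: randomized_connection_set_def)
  moreover have "T - {\<one>} \<subseteq> ?S C" by (auto simp: randomized_connection_set_def)
  ultimately show ?thesis using Ff Fc by (intro exI[of _ "?S C"] exI[of _ F]) (simp add: F_def)
qed

lemma exists_separating_set:
  assumes T: "finite T" "T \<subseteq> carrier G" "m_inv G ` T = T" "generate G T = carrier G"
  shows "\<exists>S F. finite S \<and> S \<subseteq> carrier G - {\<one>} \<and> m_inv G ` S = S \<and> T - {\<one>} \<subseteq> S \<and>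
    finite F \<and> F \<subseteq> carrier G \<and> \<one> \<in> F \<and> separating_set S T F"
proof (cases "finite (carrier G)")
  case True
  let ?S = "carrier G - {\<one>}"
  have "separating_set ?S T (carrier G)"
    unfolding separating_set_def
  proof (intro ballI impI)
    fix t h x' assume th: "t \<in> T" "h \<in> carrier G" and x': "x' \<in> carrier G"
      and *: "\<forall>y\<in>carrier G. inv (t \<otimes> h) \<otimes> y \<in> ?S \<longrightarrow> inv x' \<otimes> y \<in> ?S"
    have c: "t \<otimes> h \<in> carrier G" using th T by auto
    \<comment> \<open>The test vertex is \<open>y = x'\<close> itself: no vertex of the complete
      graph is adjacent to itself, whereas every other vertex is adjacent to
      \<open>x'\<close>.\<close>
    have "inv (t \<otimes> h) \<otimes> x' \<notin> ?S" using *[rule_format, OF x'] x' by auto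
    then have "inv (t \<otimes> h) \<otimes> x' = \<one>" using c x' by auto
    then show "x' = t \<otimes> h" using c x' by (metis inv_equality inv_inv inv_closed)
  qed
  moreover have "m_inv G ` ?S = ?S"
  proof
    show "m_inv G ` ?S \<subseteq> ?S" by auto
    show "?S \<subseteq> m_inv G ` ?S"
    proof
      fix s assume "s \<in> ?S"
      then have "inv s \<in> ?S" "s = inv (inv s)" by auto
      then show "s \<in> m_inv G ` ?S" by (rule rev_image_eqI)
    qed
  qed
  ultimately show ?thesis
    using True T(2) by (intro exI[of _ ?S] exI[of _ "carrier G"]) auto
next
  case False
  then show ?thesis using exists_separating_set_infinite T by blast
qed

end

section \<open>Finite presentations in terms of words\<close>

lemma free_group_class:
  assumes "u \<in> words X" shows "free_rel X `` {u} \<in> carrier (free_group X)"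
  using assms by (auto simp: free_group_def quotient_def)

lemma free_group_class_cases:
  assumes "A \<in> carrier (free_group X)"
  obtains u where "u \<in> words X" "A = free_rel X `` {u}"
  using assms by (auto simp: free_group_def quotient_def)

lemma free_rel_class_eq:
  "u \<in> words X \<Longrightarrow> v \<in> words X \<Longrightarrow> free_rel X `` {u} = free_rel X `` {v} \<longleftrightarrow> free_eq X u v"
  using eq_equiv_class_iff[OF equiv_free_rel, of u X v] by (simp add: free_rel_def)

lemma one_free_group: "\<one>\<^bsub>free_group X\<^esub> = free_rel X `` {[]}"
  by (simp add: free_group_def)

text \<open>The preimage in the words of a normal subgroup of the free group.\<close>

locale normal_word_set =
  fixes X :: "'x set" and M :: "'x word set"
  assumes subset_words: "M \<subseteq> words X"
    and Nil_mem: "[] \<in> M"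
    and append_mem: "u \<in> M \<Longrightarrow> v \<in> M \<Longrightarrow> u @ v \<in> M"
    and free_eq_mem: "u \<in> M \<Longrightarrow> free_eq X u v \<Longrightarrow> v \<in> M"
    and inverse_mem: "u \<in> M \<Longrightarrow> free_eq X (u @ v) [] \<Longrightarrow> v \<in> M"
    and conjugate_mem: "u \<in> M \<Longrightarrow> free_eq X (v @ v') [] \<Longrightarrow> v @ u @ v' \<in> M"

text \<open>This puts the classes of \<open>M\<close> among the subgroups intersected in
  \<open>normal_closure\<close>. No formal inverse of a word is needed: \<open>inv_class\<close>
  finds a word representing the inverse class, and the closure conditions on \<open>M\<close> accept
  any such word.\<close>

lemma (in normal_word_set) classes_normal:
  "(\<lambda>u. free_rel X `` {u}) ` M \<lhd> free_group X"
proof -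
  interpret F: group "free_group X" by (rule free_group_is_group)
  let ?c = "\<lambda>u. free_rel X `` {u}"
  have Mw: "u \<in> words X" if "u \<in> M" for u using subset_words that by blast
  have nil: "[] \<in> words X" by (simp add: words_def)
  have inv_class: "\<exists>v\<in>words X. inv\<^bsub>free_group X\<^esub> (?c u) = ?c v \<and> free_eq X (u @ v) []"
    if u: "u \<in> words X" for u
  proof -
    have "inv\<^bsub>free_group X\<^esub> (?c u) \<in> carrier (free_group X)" using free_group_class[OF u] by simp
    then obtain v where v: "v \<in> words X" "inv\<^bsub>free_group X\<^esub> (?c u) = ?c v"
      by (rule free_group_class_cases)
    have "?c u \<otimes>\<^bsub>free_group X\<^esub> ?c v = ?c []"
      using F.r_inv[OF free_group_class[OF u]] v(2) by (simp add: one_free_group)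
    then have "?c (u @ v) = ?c []" by (simp only: free_group_mult[OF u v(1)])
    then have "free_eq X (u @ v) []" using free_rel_class_eq u v(1) nil words_append by blast
    then show ?thesis using v by blast
  qed
  show ?thesis
    unfolding F.normal_inv_iff
  proof (intro conjI ballI F.subgroupI)
    show "?c ` M \<subseteq> carrier (free_group X)" using Mw free_group_class by blast
    show "?c ` M \<noteq> {}" using Nil_mem by blast
  next
    fix A assume "A \<in> ?c ` M"
    then obtain u where u: "u \<in> M" "A = ?c u" by auto
    then obtain v where "v \<in> words X" "inv\<^bsub>free_group X\<^esub> A = ?c v" "free_eq X (u @ v) []"
      using inv_class[OF Mw] by blast
    then show "inv\<^bsub>free_group X\<^esub> A \<in> ?c ` M" using u inverse_mem by blast
  next
    fix A B assume "A \<in> ?c ` M" "B \<in> ?c ` M"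
    then obtain u v where u: "u \<in> M" "A = ?c u" "v \<in> M" "B = ?c v" by auto
    then have "u @ v \<in> M" using append_mem by blast
    then show "A \<otimes>\<^bsub>free_group X\<^esub> B \<in> ?c ` M"
      using u Mw by (simp add: free_group_mult)
  next
    fix A B assume A: "A \<in> carrier (free_group X)" and "B \<in> ?c ` M"
    then obtain u where u: "u \<in> M" "B = ?c u" by auto
    obtain v where v: "v \<in> words X" "A = ?c v" using A by (rule free_group_class_cases)
    then obtain v' where v': "v' \<in> words X" "inv\<^bsub>free_group X\<^esub> A = ?c v'" "free_eq X (v @ v') []"
      using inv_class by blast
    have "v @ u @ v' \<in> M" using u v' conjugate_mem by blast
    moreover have "A \<otimes>\<^bsub>free_group X\<^esub> B \<otimes>\<^bsub>free_group X\<^esub> inv\<^bsub>free_group X\<^esub> A = ?c (v @ u @ v')"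
      using u v v' Mw by (simp only: free_group_mult words_append) simp
    ultimately show "A \<otimes>\<^bsub>free_group X\<^esub> B \<otimes>\<^bsub>free_group X\<^esub> inv\<^bsub>free_group X\<^esub> A \<in> ?c ` M" by blast
  qed
qed

text \<open>The presentation is restated so that cosets and classes disappear. The last clause is
  the universal property used later: a word set that contains the relators and is closed like a
  normal subgroup contains every word of trivial value. \<open>ev\<close> is the composite of class,
  coset and the given isomorphism, so its kernel consists of the words whose class lies in
  \<open>N\<close>.\<close>

lemma finitely_presented_words:
  fixes G (structure)
  assumes "group G" "finitely_presented G"
  obtains X :: "nat set" and Rel ev where
    "finite X" "finite Rel" "Rel \<subseteq> words X" "\<And>w. w \<in> words X \<Longrightarrow> ev w \<in> carrier G"
    "ev [] = \<one>" "\<And>u v. u \<in> words X \<Longrightarrow> v \<in> words X \<Longrightarrow> ev (u @ v) = ev u \<otimes> ev v"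
    "\<And>u v. free_eq X u v \<Longrightarrow> ev u = ev v" "ev ` words X = carrier G"
    "\<And>r. r \<in> Rel \<Longrightarrow> ev r = \<one>"
    "\<And>M w. normal_word_set X M \<Longrightarrow> Rel \<subseteq> M \<Longrightarrow> w \<in> words X \<Longrightarrow> ev w = \<one> \<Longrightarrow> w \<in> M"
proof -
  interpret G: group G by fact
  obtain X :: "nat set" and R where X: "finite X" "finite R" "R \<subseteq> carrier (free_group X)"
    and iso: "free_group X Mod normal_closure (free_group X) R \<cong> G"
    using assms(2) by (auto simp: finitely_presented_def)
  let ?F = "free_group X"
  let ?c = "\<lambda>u. free_rel X `` {u}"
  define N where "N = normal_closure ?F R"
  interpret F: group ?F by (rule free_group_is_group)
  have nN: "N \<lhd> ?F" using normal_closure_normal[OF F.group_axioms X(3)] by (simp add: N_def)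
  interpret N: normal N ?F by (rule nN)
  interpret Q: group "?F Mod N" by (rule N.factorgroup_is_group)
  obtain h where h: "h \<in> iso (?F Mod N) G" using iso by (auto simp: is_iso_def N_def)
  then have hhom: "h \<in> hom (?F Mod N) G" and hbij: "bij_betw h (carrier (?F Mod N)) (carrier G)"
    by (auto simp: iso_def)
  define ev where "ev u = h (N #>\<^bsub>?F\<^esub> ?c u)" for u
  have phom: "(\<lambda>a. N #>\<^bsub>?F\<^esub> a) \<in> hom ?F (?F Mod N)" by (rule N.r_coset_hom_Mod)
  have ehom: "(\<lambda>a. h (N #>\<^bsub>?F\<^esub> a)) \<in> hom ?F G"
    using hom_compose[OF phom hhom] by (simp add: comp_def)
  have R_N: "R \<subseteq> N" by (auto simp: N_def normal_closure_def)
  have nil: "[] \<in> words X" by (simp add: words_def)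
  have evc: "ev w \<in> carrier G" if "w \<in> words X" for w
    using hom_in_carrier[OF ehom free_group_class[OF that]] by (simp add: ev_def)
  have ker: "ev w = \<one> \<longleftrightarrow> ?c w \<in> N" if w: "w \<in> words X" for w
  proof -
    have N1: "N = \<one>\<^bsub>?F Mod N\<^esub>" by (simp add: FactGroup_def)
    have h1: "h N = \<one>" using hom_one[OF hhom Q.group_axioms assms(1)] N1 by simp
    have cc: "N #>\<^bsub>?F\<^esub> ?c w \<in> carrier (?F Mod N)"
      using hom_in_carrier[OF phom free_group_class[OF w]] .
    have "ev w = \<one> \<longleftrightarrow> N #>\<^bsub>?F\<^esub> ?c w = N"
      using hbij cc Q.one_closed h1 N1 unfolding ev_def bij_betw_def by (metis inj_onD)
    also have "\<dots> \<longleftrightarrow> ?c w \<in> N"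
      using F.coset_join1[of N "?c w"] F.coset_join2[of "?c w" N] free_group_class[OF w]
        N.subset N.subgroup_axioms by blast
    finally show ?thesis .
  qed
  define Rel where "Rel = (\<lambda>A. SOME u. u \<in> words X \<and> A = ?c u) ` R"
  have Rel: "\<exists>u\<in>Rel. u \<in> words X \<and> A = ?c u" if "A \<in> R" for A
  proof -
    have "\<exists>u. u \<in> words X \<and> A = ?c u" using X(3) that by (auto elim: free_group_class_cases)
    then have "(SOME u. u \<in> words X \<and> A = ?c u) \<in> words X \<and> A = ?c (SOME u. u \<in> words X \<and> A = ?c u)"
      by (rule someI_ex)
    then show ?thesis using that by (auto simp: Rel_def)
  qed
  have Rel': "u \<in> words X \<and> ?c u \<in> R" if "u \<in> Rel" for u
  proof -
    obtain A where A: "A \<in> R" "u = (SOME u. u \<in> words X \<and> A = ?c u)" using \<open>u \<in> Rel\<close> by (auto simp: Rel_def)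
    have "\<exists>u. u \<in> words X \<and> A = ?c u" using X(3) A(1) by (auto elim: free_group_class_cases)
    then have "u \<in> words X \<and> A = ?c u" unfolding A(2) by (rule someI_ex)
    then show ?thesis using A(1) by auto
  qed
  show ?thesis
  proof (rule that[of X Rel ev])
    show "finite X" "finite Rel" using X by (auto simp: Rel_def)
    show "Rel \<subseteq> words X" using Rel' by auto
    show "ev w \<in> carrier G" if "w \<in> words X" for w using evc[OF that] .
    show "ev [] = \<one>" using hom_one[OF ehom F.group_axioms assms(1)] by (simp add: ev_def one_free_group)
    show "ev (u @ v) = ev u \<otimes> ev v" if "u \<in> words X" "v \<in> words X" for u v
      using hom_mult[OF ehom free_group_class[OF that(1)] free_group_class[OF that(2)]]
      by (simp only: free_group_mult[OF that] ev_def)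
    show "ev u = ev v" if "free_eq X u v" for u v
      using that free_eq_words[OF that] free_rel_class_eq[of u X v] by (simp add: ev_def)
    show "ev ` words X = carrier G"
    proof
      show "ev ` words X \<subseteq> carrier G" using evc by blast
      show "carrier G \<subseteq> ev ` words X"
      proof
        fix g assume "g \<in> carrier G"
        then obtain q where q: "q \<in> carrier (?F Mod N)" "g = h q" using hbij by (auto simp: bij_betw_def)
        then obtain A where A: "A \<in> carrier ?F" "q = N #>\<^bsub>?F\<^esub> A"
          by (auto simp: FactGroup_def RCOSETS_def)
        obtain u where "u \<in> words X" "A = ?c u" using A(1) by (rule free_group_class_cases)
        then show "g \<in> ev ` words X" using q A by (auto simp: ev_def)
      qed
    qed
    show "ev r = \<one>" if "r \<in> Rel" for r using Rel'[OF that] R_N ker by blast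
    show "w \<in> M" if M: "normal_word_set X M" "Rel \<subseteq> M" and w: "w \<in> words X" "ev w = \<one>" for M w
    proof -
      \<comment> \<open>The classes of \<open>M\<close> form a normal subgroup containing the
        relators, hence contain \<open>N\<close>. Invariance of \<open>M\<close> under
        \<open>free_eq\<close> then leads from the class of \<open>w\<close> back to
        \<open>w\<close> itself.\<close>
      have "R \<subseteq> ?c ` M" using Rel M(2) by blast
      then have "N \<subseteq> ?c ` M"
        unfolding N_def normal_closure_def
        using normal_word_set.classes_normal[OF M(1)] by blast
      then obtain u where u: "u \<in> M" "?c w = ?c u" using ker[OF w(1)] w(2) by blast
      have "u \<in> words X" using u normal_word_set.subset_words[OF M(1)] by blast
      then have "free_eq X u w" using free_rel_class_eq[of u X w] w(1) u(2) by simp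
      then show ?thesis using normal_word_set.free_eq_mem[OF M(1)] u by blast
    qed
  qed
qed

section \<open>Local isomorphisms\<close>

text \<open>Walks of length at most \<open>n\<close> become walks of exactly \<open>n\<close> steps
  in the reflexive closure. This gives a plain recursion in \<open>n\<close> without a minimum over
  walks and without a vertex set.\<close>

definition edge_ball :: "'v rel \<Rightarrow> 'v \<Rightarrow> nat \<Rightarrow> 'v set" where
  "edge_ball E x n = (E\<^sup>= ^^ n) `` {x}"

lemma edge_ball_0 [simp]: "edge_ball E x 0 = {x}"
  by (simp add: edge_ball_def)

lemma edge_ball_Suc: "edge_ball E x (Suc n) = edge_ball E x n \<union> E `` edge_ball E x n"
  by (auto simp: edge_ball_def)

lemma edge_ball_trans: "a \<in> edge_ball E x c \<Longrightarrow> b \<in> edge_ball E a n \<Longrightarrow> b \<in> edge_ball E x (c + n)"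
  by (auto simp: edge_ball_def relpow_add)

lemma edge_ball_mono: "m \<le> n \<Longrightarrow> edge_ball E x m \<subseteq> edge_ball E x n"
  by (rule lift_Suc_mono_le[of "edge_ball E x"]) (auto simp: edge_ball_Suc)

lemma center_in_edge_ball [simp]: "x \<in> edge_ball E x n"
  using edge_ball_mono[of 0 n E x] by simp

lemma edge_ball_relpow: "edge_ball E x n = (\<Union>k\<le>n. (E ^^ k) `` {x})"
proof (induction n)
  case (Suc n)
  have "E `` ((E ^^ k) `` {x}) = (E ^^ Suc k) `` {x}" for k by auto
  then have "E `` (\<Union>k\<le>n. (E ^^ k) `` {x}) = (\<Union>k\<le>n. (E ^^ Suc k) `` {x})" by blast
  moreover have "{..Suc n} = insert 0 (Suc ` {..n})"
    using atMost_Suc_eq_insert_0 by blast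
  moreover have "x \<in> (\<Union>k\<le>n. (E ^^ k) `` {x})" by (rule UN_I[of 0]) auto
  moreover have "(\<Union>k\<le>n. (E ^^ k) `` {x}) \<subseteq> (\<Union>k\<le>Suc n. (E ^^ k) `` {x})"
    by (rule UN_mono) auto
  ultimately show ?case
    unfolding edge_ball_Suc Suc.IH by (simp del: relpow.simps(2)) auto
qed simp

lemma edge_ball_rtrancl: "(x, y) \<in> E\<^sup>* \<Longrightarrow> \<exists>n. y \<in> edge_ball E x n"
  by (auto simp: edge_ball_relpow dest!: rtrancl_imp_relpow)

lemma finite_in_edge_ball:
  assumes "finite A" "\<And>y. y \<in> A \<Longrightarrow> (x, y) \<in> E\<^sup>*"
  shows "\<exists>n. A \<subseteq> edge_ball E x n"
proof -
  obtain f where f: "\<And>y. y \<in> A \<Longrightarrow> y \<in> edge_ball E x (f y)"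
    using edge_ball_rtrancl assms(2) by metis
  have "y \<in> edge_ball E x (Max (f ` A))" if "y \<in> A" for y
    using f[OF that] edge_ball_mono[of "f y" "Max (f ` A)" E x] assms(1) that by auto
  then show ?thesis by blast
qed

lemma pverts_graph_ball:
  assumes "connected_simple_graph X" "x \<in> pverts X"
  shows "pverts (graph_ball X x R) = edge_ball (parcs X) x R"
proof -
  have wf: "parcs X \<subseteq> pverts X \<times> pverts X"
    and conn: "\<And>y. y \<in> pverts X \<Longrightarrow> (x, y) \<in> (parcs X)\<^sup>*"
    using assms by (auto simp: connected_simple_graph_iff)
  have ball: "y \<in> pverts X" if "y \<in> edge_ball (parcs X) x n" for y n
    using that by (induction n arbitrary: y) (use wf assms(2) in \<open>auto simp: edge_ball_Suc\<close>)
  have "graph_dist X x y \<le> R \<longleftrightarrow> y \<in> edge_ball (parcs X) x R" if y: "y \<in> pverts X" for y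
  proof
    assume le: "graph_dist X x y \<le> R"
    \<comment> \<open>Connectedness matters here: without a walk the \<open>LEAST\<close> in
      \<open>graph_dist\<close> would be unspecified.\<close>
    obtain n where "(x, y) \<in> parcs X ^^ n" using conn[OF y] rtrancl_imp_relpow by metis
    then have "(x, y) \<in> parcs X ^^ graph_dist X x y"
      unfolding graph_dist_relpow[OF wf assms(2)] by (rule LeastI)
    then show "y \<in> edge_ball (parcs X) x R" using le by (auto simp: edge_ball_relpow)
  next
    assume "y \<in> edge_ball (parcs X) x R"
    then obtain k where k: "k \<le> R" "(x, y) \<in> parcs X ^^ k" by (auto simp: edge_ball_relpow)
    have "graph_dist X x y \<le> k"
      unfolding graph_dist_relpow[OF wf assms(2)] using k(2) by (rule Least_le)
    then show "graph_dist X x y \<le> R" using k(1) by simp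
  qed
  then show ?thesis using ball by (auto simp: graph_ball_def Let_def)
qed

definition local_iso :: "'v rel \<Rightarrow> 'w rel \<Rightarrow> ('v \<Rightarrow> 'w) \<Rightarrow> 'v \<Rightarrow> nat \<Rightarrow> bool" where
  "local_iso E E' e x n \<longleftrightarrow> inj_on e (edge_ball E x n) \<and>
     e ` edge_ball E x n = edge_ball E' (e x) n \<and>
     (\<forall>u\<in>edge_ball E x n. \<forall>v\<in>edge_ball E x n. (u, v) \<in> E \<longleftrightarrow> (e u, e v) \<in> E')"

lemma local_isoD:
  assumes "local_iso E E' e x n"
  shows "inj_on e (edge_ball E x n)" "e ` edge_ball E x n = edge_ball E' (e x) n"
    "u \<in> edge_ball E x n \<Longrightarrow> v \<in> edge_ball E x n \<Longrightarrow> (e u, e v) \<in> E' \<longleftrightarrow> (u, v) \<in> E"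
  using assms by (auto simp: local_iso_def)

text \<open>Images of walks are walks as long as they stay in the large ball, which gives one
  inclusion between the balls around \<open>a\<close> and \<open>e a\<close>. Conversely, a walk in
  the target starting at \<open>e a\<close> stays within distance \<open>c + n\<close> of
  \<open>e x\<close>, so it lifts step by step, because edges are also reflected.\<close>

lemma local_iso_shift:
  assumes e: "local_iso E E' e x (c + n)" and a: "a \<in> edge_ball E x c"
  shows "local_iso E E' e a n"
proof -
  note D = local_isoD[OF e]
  have sub: "edge_ball E a k \<subseteq> edge_ball E x (c + k)" for k using edge_ball_trans[OF a] by blast
  have sub': "edge_ball E a k \<subseteq> edge_ball E x (c + n)" if "k \<le> n" for k
    using sub[of k] edge_ball_mono[of "c + k" "c + n" E x] that by auto
  have fwd: "e ` edge_ball E x k \<subseteq> edge_ball E' (e x) k" if "k \<le> c + n" for k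
    using that
  proof (induction k)
    case (Suc k)
    have "e v \<in> edge_ball E' (e x) (Suc k)" if v: "v \<in> edge_ball E x (Suc k)" for v
    proof (cases "v \<in> edge_ball E x k")
      case True
      then show ?thesis using Suc by (auto simp: edge_ball_Suc)
    next
      case False
      then obtain u where u: "u \<in> edge_ball E x k" "(u, v) \<in> E" using v by (auto simp: edge_ball_Suc)
      have "u \<in> edge_ball E x (c + n)" "v \<in> edge_ball E x (c + n)"
        using u(1) v edge_ball_mono[of k "c + n" E x] edge_ball_mono[of "Suc k" "c + n" E x] Suc.prems
        by auto
      then have "(e u, e v) \<in> E'" using D(3) u(2) by blast
      moreover have "e u \<in> edge_ball E' (e x) k" using Suc u(1) by auto
      ultimately show ?thesis by (auto simp: edge_ball_Suc)
    qed
    then show ?case by auto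
  qed simp
  have img: "e ` edge_ball E a k = edge_ball E' (e a) k" if "k \<le> n" for k
    using that
  proof (induction k)
    case (Suc k)
    then have IH: "e ` edge_ball E a k = edge_ball E' (e a) k" by simp
    show ?case
    proof
      show "e ` edge_ball E a (Suc k) \<subseteq> edge_ball E' (e a) (Suc k)"
      proof (rule image_subsetI)
        fix v assume v: "v \<in> edge_ball E a (Suc k)"
        show "e v \<in> edge_ball E' (e a) (Suc k)"
        proof (cases "v \<in> edge_ball E a k")
          case True
          then show ?thesis using IH by (auto simp: edge_ball_Suc)
        next
          case False
          then obtain u where u: "u \<in> edge_ball E a k" "(u, v) \<in> E" using v by (auto simp: edge_ball_Suc)
          have "u \<in> edge_ball E x (c + n)" "v \<in> edge_ball E x (c + n)"
            using u(1) v sub'[of k] sub'[of "Suc k"] Suc.prems by auto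
          then have "(e u, e v) \<in> E'" using D(3) u(2) by blast
          moreover have "e u \<in> edge_ball E' (e a) k" using IH u(1) by auto
          ultimately show ?thesis by (auto simp: edge_ball_Suc)
        qed
      qed
      show "edge_ball E' (e a) (Suc k) \<subseteq> e ` edge_ball E a (Suc k)"
      proof
        fix z assume z: "z \<in> edge_ball E' (e a) (Suc k)"
        show "z \<in> e ` edge_ball E a (Suc k)"
        proof (cases "z \<in> edge_ball E' (e a) k")
          case True
          then have "z \<in> e ` edge_ball E a k" using IH by simp
          then show ?thesis by (auto simp: edge_ball_Suc)
        next
          case False
          then obtain y where y: "y \<in> edge_ball E' (e a) k" "(y, z) \<in> E'"
            using z by (auto simp: edge_ball_Suc)
          then obtain u where u: "u \<in> edge_ball E a k" "y = e u" using IH by auto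
          \<comment> \<open>The end \<open>z\<close> of the next edge is not yet known to be in the
            image. Bounding its distance from \<open>e x\<close> by \<open>c + n\<close> yields a
            preimage.\<close>
          have "e u \<in> edge_ball E' (e x) (c + k)"
            using fwd[of "c + k"] sub[of k] u(1) Suc.prems by auto
          then have "z \<in> edge_ball E' (e x) (Suc (c + k))" using y u by (auto simp: edge_ball_Suc)
          then have "z \<in> edge_ball E' (e x) (c + n)"
            using edge_ball_mono[of "Suc (c + k)" "c + n" E' "e x"] Suc.prems by auto
          then obtain v where v: "v \<in> edge_ball E x (c + n)" "z = e v" using D(2) by blast
          have "u \<in> edge_ball E x (c + n)" using u(1) sub'[of k] Suc.prems by auto
          then have "(u, v) \<in> E" using D(3) v y u by blast
          then show ?thesis using u(1) v(2) by (auto simp: edge_ball_Suc)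
        qed
      qed
    qed
  qed simp
  show ?thesis
    unfolding local_iso_def
  proof (intro conjI ballI)
    show "inj_on e (edge_ball E a n)" using D(1) sub'[of n] inj_on_subset by blast
    show "e ` edge_ball E a n = edge_ball E' (e a) n" by (rule img) simp
    show "(u, v) \<in> E \<longleftrightarrow> (e u, e v) \<in> E'" if "u \<in> edge_ball E a n" "v \<in> edge_ball E a n" for u v
      using D(3)[of u v] sub'[of n] that by auto
  qed
qed

lemma local_iso_antimono:
  "local_iso E E' e x n \<Longrightarrow> m \<le> n \<Longrightarrow> local_iso E E' e x m"
  using local_iso_shift[of E E' e x "n - m" m x] by simp

lemma local_iso_comp:
  assumes e: "local_iso E E' e x n" and f: "local_iso E' E'' f (e x) n"
  shows "local_iso E E'' (\<lambda>u. f (e u)) x n"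
  unfolding local_iso_def
proof (intro conjI ballI)
  note De = local_isoD[OF e] and Df = local_isoD[OF f]
  have "inj_on (f \<circ> e) (edge_ball E x n)" using De(1,2) Df(1) by (intro comp_inj_on) simp_all
  then show "inj_on (\<lambda>u. f (e u)) (edge_ball E x n)" by (simp add: comp_def)
  show "(\<lambda>u. f (e u)) ` edge_ball E x n = edge_ball E'' (f (e x)) n"
    using De(2) Df(2) by (metis image_image)
  show "(u, v) \<in> E \<longleftrightarrow> (f (e u), f (e v)) \<in> E''"
    if uv: "u \<in> edge_ball E x n" "v \<in> edge_ball E x n" for u v
  proof -
    have "e u \<in> edge_ball E' (e x) n" "e v \<in> edge_ball E' (e x) n" using De(2) uv by auto
    then show ?thesis using De(3)[OF uv] Df(3) by simp
  qed
qed

lemma local_iso_inverse: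
  assumes e: "local_iso E E' e x n"
  shows "local_iso E' E (inv_into (edge_ball E x n) e) (e x) n"
proof -
  note D = local_isoD[OF e]
  let ?i = "inv_into (edge_ball E x n) e"
  have ix: "?i (e x) = x" using D(1) by simp
  have mem: "?i y \<in> edge_ball E x n" "e (?i y) = y" if "y \<in> edge_ball E' (e x) n" for y
    using that unfolding D(2)[symmetric] by (rule inv_into_into, rule f_inv_into_f)
  show ?thesis
    unfolding local_iso_def
  proof (intro conjI ballI)
    show "inj_on ?i (edge_ball E' (e x) n)" using inj_on_inv_into[of _ e] D(2) by blast
    show "?i ` edge_ball E' (e x) n = edge_ball E (?i (e x)) n"
      unfolding ix D(2)[symmetric] using D(1) by simp
    show "(y, z) \<in> E' \<longleftrightarrow> (?i y, ?i z) \<in> E"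
      if "y \<in> edge_ball E' (e x) n" "z \<in> edge_ball E' (e x) n" for y z
      using D(3)[OF mem(1)[OF that(1)] mem(1)[OF that(2)]] mem(2)[OF that(1)] mem(2)[OF that(2)] by simp
  qed
qed

lemma graph_isomorphism_local_iso:
  assumes X: "connected_simple_graph X" "x \<in> pverts X" and Y: "connected_simple_graph Y" "y \<in> pverts Y"
    and f: "graph_isomorphism f (graph_ball X x R) (graph_ball Y y R)" "f x = y"
  shows "local_iso (parcs X) (parcs Y) f x R"
proof -
  have P: "pverts (graph_ball X x R) = edge_ball (parcs X) x R"
    "pverts (graph_ball Y y R) = edge_ball (parcs Y) y R"
    by (rule pverts_graph_ball[OF X], rule pverts_graph_ball[OF Y])
  have A: "parcs (graph_ball X x R) = parcs X \<inter> (edge_ball (parcs X) x R \<times> edge_ball (parcs X) x R)"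
    "parcs (graph_ball Y y R) = parcs Y \<inter> (edge_ball (parcs Y) y R \<times> edge_ball (parcs Y) y R)"
    unfolding P[symmetric] by (simp_all add: graph_ball_def Let_def)
  have "inj_on f (edge_ball (parcs X) x R)" "f ` edge_ball (parcs X) x R = edge_ball (parcs Y) y R"
    using f(1) by (auto simp: graph_isomorphism_def bij_betw_def P)
  moreover have "(u, v) \<in> parcs X \<longleftrightarrow> (f u, f v) \<in> parcs Y"
    if "u \<in> edge_ball (parcs X) x R" "v \<in> edge_ball (parcs X) x R" for u v
  proof -
    have "(u, v) \<in> parcs (graph_ball X x R) \<longleftrightarrow> (f u, f v) \<in> parcs (graph_ball Y y R)"
      using f(1) that by (auto simp: graph_isomorphism_def P)
    moreover have "f u \<in> edge_ball (parcs Y) y R" "f v \<in> edge_ball (parcs Y) y R"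
      using calculation(1) that \<open>f ` _ = _\<close> by auto
    ultimately show ?thesis using that by (simp add: A)
  qed
  ultimately show ?thesis using f(2) by (auto simp: local_iso_def)
qed

text \<open>Among the indices from \<open>m\<close> on, take one with the smallest cardinality; the
  next set is contained in it and has the same size.\<close>

lemma decseq_finite_stabilises:
  assumes dec: "\<And>n. A (Suc n) \<subseteq> A n" and fin: "\<And>n. n \<ge> m \<Longrightarrow> finite (A n)"
  shows "\<exists>n\<ge>m. A (Suc n) = A n"
proof -
  have "\<exists>n. m \<le> n \<and> (\<forall>k. m \<le> k \<longrightarrow> card (A n) \<le> card (A k))"
    by (rule ex_has_least_nat[of _ m]) simp
  then obtain n where n: "m \<le> n" "\<forall>k. m \<le> k \<longrightarrow> card (A n) \<le> card (A k)" by (elim exE conjE)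
  have "card (A n) \<le> card (A (Suc n))" using n by simp
  then have "card (A (Suc n)) = card (A n)" using card_mono[OF fin[OF n(1)] dec] by (rule antisym[rotated])
  then have "A (Suc n) = A n" by (rule card_subset_eq[OF fin[OF n(1)] dec])
  then show ?thesis using n(1) by (intro exI[of _ n] conjI)
qed

section \<open>Germs of charts and the covering\<close>

context group begin

lemma Cay_edge_iff:
  "(g, h) \<in> parcs (Cay G S) \<longleftrightarrow> g \<in> carrier G \<and> h \<in> carrier G \<and> inv g \<otimes> h \<in> S"
  by (simp add: Cay_def)

lemma edge_ball_Cay_subset: "g \<in> carrier G \<Longrightarrow> edge_ball (parcs (Cay G S)) g n \<subseteq> carrier G"
  by (induction n) (auto simp: edge_ball_Suc Cay_edge_iff)

lemma Cay_translate_edge: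
  assumes "a \<in> carrier G" "g \<in> carrier G" "h \<in> carrier G"
  shows "(a \<otimes> g, a \<otimes> h) \<in> parcs (Cay G S) \<longleftrightarrow> (g, h) \<in> parcs (Cay G S)"
proof -
  have "inv (a \<otimes> g) \<otimes> (a \<otimes> h) = inv g \<otimes> (inv a \<otimes> a \<otimes> h)"
    using assms by (simp only: inv_mult_group m_assoc inv_closed m_closed)
  then show ?thesis using assms by (simp add: Cay_edge_iff)
qed

lemma local_iso_translation:
  assumes a: "a \<in> carrier G" and g: "g \<in> carrier G"
  shows "local_iso (parcs (Cay G S)) (parcs (Cay G S)) (\<lambda>h. a \<otimes> h) g n"
proof -
  let ?E = "parcs (Cay G S)"
  have sub: "(\<otimes>) a ` edge_ball ?E g n \<subseteq> edge_ball ?E (a \<otimes> g) n"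
    if a: "a \<in> carrier G" and g: "g \<in> carrier G" for a g n
  proof (induction n)
    case (Suc n)
    have "a \<otimes> v \<in> edge_ball ?E (a \<otimes> g) (Suc n)" if v: "v \<in> ?E `` edge_ball ?E g n" for v
    proof -
      obtain u where u: "u \<in> edge_ball ?E g n" "(u, v) \<in> ?E" using v by blast
      then have "(a \<otimes> u, a \<otimes> v) \<in> ?E" using a by (subst Cay_translate_edge) (auto simp: Cay_edge_iff)
      then show ?thesis using Suc.IH u(1) by (auto simp: edge_ball_Suc)
    qed
    then show ?case using Suc.IH unfolding edge_ball_Suc by blast
  qed simp
  have c: "edge_ball ?E g n \<subseteq> carrier G" by (rule edge_ball_Cay_subset[OF g])
  have "edge_ball ?E (a \<otimes> g) n \<subseteq> (\<otimes>) a ` edge_ball ?E g n"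
  proof
    \<comment> \<open>The reverse inclusion is \<open>sub\<close> for translation by
      \<open>inv a\<close>.\<close>
    fix v assume v: "v \<in> edge_ball ?E (a \<otimes> g) n"
    have vc: "v \<in> carrier G" using v edge_ball_Cay_subset[of "a \<otimes> g"] a g by blast
    have "inv a \<otimes> (a \<otimes> g) = g" using a g by (simp add: m_assoc[symmetric])
    then have "inv a \<otimes> v \<in> edge_ball ?E g n"
      using sub[of "inv a" "a \<otimes> g" n] v a g by force
    moreover have "v = a \<otimes> (inv a \<otimes> v)" using a vc by (simp add: m_assoc[symmetric])
    ultimately show "v \<in> (\<otimes>) a ` edge_ball ?E g n" by blast
  qed
  then have "(\<otimes>) a ` edge_ball ?E g n = edge_ball ?E (a \<otimes> g) n" using sub[OF a g] by blast
  moreover have "inj_on ((\<otimes>) a) (edge_ball ?E g n)"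
    using inj_on_cmult[OF a] c by (rule inj_on_subset)
  ultimately show ?thesis
    using Cay_translate_edge[OF a] c by (auto simp: local_iso_def subset_iff)
qed

end

text \<open>\<open>K\<close> bounds the words that must be compared directly: relators, chosen words
  for the elements of \<open>S\<close>, and cancelling pairs, hence the 2. The ball of radius
  \<open>\<rho>\<close> contains \<open>F\<close> and its translates by letters.
  \<open>R_extend\<close> is the stabilisation of germs at radius \<open>R\<close>. A letter may
  have value \<open>\<one>\<close>, which \<open>S\<close> need not contain.\<close>

locale rigid_cayley = group G for G (structure) +
  fixes X :: "'x set" and Rel :: "'x word set" and ev :: "'x word \<Rightarrow> 'a"
    and S F :: "'a set" and K \<rho> R :: nat
  assumes Rel_words: "Rel \<subseteq> words X"
    and ev_closed: "w \<in> words X \<Longrightarrow> ev w \<in> carrier G"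
    and ev_Nil: "ev [] = \<one>"
    and ev_append: "u \<in> words X \<Longrightarrow> v \<in> words X \<Longrightarrow> ev (u @ v) = ev u \<otimes> ev v"
    and ev_free_eq: "free_eq X u v \<Longrightarrow> ev u = ev v"
    and ev_onto: "ev ` words X = carrier G"
    and ev_Rel: "r \<in> Rel \<Longrightarrow> ev r = \<one>"
    and presentation: "normal_word_set X M \<Longrightarrow> Rel \<subseteq> M \<Longrightarrow> w \<in> words X \<Longrightarrow> ev w = \<one> \<Longrightarrow> w \<in> M"
    and S_carrier: "S \<subseteq> carrier G"
    and letter_S: "a \<in> X \<times> UNIV \<Longrightarrow> ev [a] \<in> insert \<one> S"
    and F_carrier: "F \<subseteq> carrier G" and one_F: "\<one> \<in> F"
    and separating: "separating_set S ((\<lambda>a. ev [a]) ` (X \<times> UNIV)) F"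
    and K: "2 \<le> K" "r \<in> Rel \<Longrightarrow> length r \<le> K"
      "s \<in> S \<Longrightarrow> \<exists>w\<in>words X. length w \<le> K \<and> ev w = s"
    and \<rho>: "F \<subseteq> edge_ball (parcs (Cay G S)) \<one> \<rho>"
      "a \<in> X \<times> UNIV \<Longrightarrow> h \<in> F \<Longrightarrow> ev [a] \<otimes> h \<in> edge_ball (parcs (Cay G S)) \<one> \<rho>"
    and R: "\<rho> + K \<le> R"
    and R_extend: "local_iso (parcs (Cay G S)) (parcs (Cay G S)) \<psi> \<one> R \<Longrightarrow> \<psi> \<one> = \<one> \<Longrightarrow>
      \<exists>\<Psi>. local_iso (parcs (Cay G S)) (parcs (Cay G S)) \<Psi> \<one> (Suc R) \<and> (\<forall>h\<in>F. \<Psi> h = \<psi> h)"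
begin

abbreviation E where "E \<equiv> parcs (Cay G S)"

lemma words_Cons: "a # w \<in> words X \<longleftrightarrow> a \<in> X \<times> UNIV \<and> w \<in> words X"
  by (auto simp: words_def)

lemma Nil_words: "[] \<in> words X" by (simp add: words_def)

lemma letter_closed: "a \<in> X \<times> UNIV \<Longrightarrow> ev [a] \<in> carrier G"
  by (rule ev_closed) (simp add: words_Cons Nil_words)

lemma ev_Cons: "a \<in> X \<times> UNIV \<Longrightarrow> w \<in> words X \<Longrightarrow> ev (a # w) = ev [a] \<otimes> ev w"
  using ev_append[of "[a]" w] by (simp add: words_Cons Nil_words)

lemma letter_ball: "a \<in> X \<times> UNIV \<Longrightarrow> ev [a] \<in> edge_ball E \<one> 1"
  using letter_S[of a] letter_closed[of a] by (auto simp: edge_ball_Suc Cay_edge_iff)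

lemma local_iso_shift_letter:
  assumes e: "local_iso E E' e \<one> (Suc n)" and a: "a \<in> X \<times> UNIV"
  shows "local_iso E E' (\<lambda>h. e (ev [a] \<otimes> h)) \<one> n"
proof -
  have "local_iso E E' e (ev [a]) n"
    by (rule local_iso_shift[of _ _ _ _ 1]) (use e letter_ball[OF a] in auto)
  then show ?thesis
    using local_iso_comp[OF local_iso_translation[OF letter_closed[OF a] one_closed]] letter_closed[OF a]
    by simp
qed

text \<open>Both maps have the same image since they agree at \<open>\<one>\<close>, so
  \<open>e\<^sub>1 ?x\<close> equals \<open>e\<^sub>2 x'\<close> for some \<open>x'\<close>.
  Agreement on \<open>F\<close> transfers every neighbour of \<open>?x\<close> in \<open>F\<close>
  to a neighbour of \<open>x'\<close>, and separation gives \<open>x' = ?x\<close>.\<close>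

lemma local_iso_rigid:
  assumes e: "local_iso E E' e\<^sub>1 \<one> n" "local_iso E E' e\<^sub>2 \<one> n" and n: "\<rho> \<le> n"
    and eq: "\<And>h. h \<in> F \<Longrightarrow> e\<^sub>1 h = e\<^sub>2 h" and a: "a \<in> X \<times> UNIV" and h: "h \<in> F"
  shows "e\<^sub>1 (ev [a] \<otimes> h) = e\<^sub>2 (ev [a] \<otimes> h)"
proof -
  let ?x = "ev [a] \<otimes> h"
  have sub: "edge_ball E \<one> \<rho> \<subseteq> edge_ball E \<one> n" by (rule edge_ball_mono[OF n])
  have x: "?x \<in> edge_ball E \<one> n" using \<rho>(2)[OF a h] sub by blast
  have Fb: "y \<in> edge_ball E \<one> n" if "y \<in> F" for y using \<rho>(1) sub that by blast
  have "e\<^sub>1 ?x \<in> edge_ball E' (e\<^sub>1 \<one>) n" using local_isoD(2)[OF e(1)] x by blast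
  then have "e\<^sub>1 ?x \<in> e\<^sub>2 ` edge_ball E \<one> n" using local_isoD(2)[OF e(2)] eq[OF one_F] by simp
  then obtain x' where x': "x' \<in> edge_ball E \<one> n" "e\<^sub>1 ?x = e\<^sub>2 x'" by blast
  have x'c: "x' \<in> carrier G" using x'(1) edge_ball_Cay_subset[OF one_closed] by blast
  have "inv x' \<otimes> y \<in> S" if y: "y \<in> F" "inv ?x \<otimes> y \<in> S" for y
  proof -
    have "(?x, y) \<in> E" using y F_carrier h letter_closed[OF a] by (auto simp: Cay_edge_iff)
    then have "(e\<^sub>2 x', e\<^sub>2 y) \<in> E'"
      using local_isoD(3)[OF e(1) x Fb[OF y(1)]] x'(2) eq[OF y(1)] by simp
    then have "(x', y) \<in> E" using local_isoD(3)[OF e(2) x'(1) Fb[OF y(1)]] by simp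
    then show ?thesis by (simp add: Cay_edge_iff)
  qed
  then have "x' = ?x" using separating a h x'c unfolding separating_set_def by blast
  then show ?thesis using x'(2) by simp
qed

text \<open>Precomposing both maps with translation by the first letter keeps them equal on
  \<open>F\<close>, by \<open>local_iso_rigid\<close>, and lowers the radius by one. The radius
  therefore exceeds \<open>\<rho>\<close> by at least the length of \<open>w\<close>.\<close>

lemma local_iso_rigid_word:
  assumes "local_iso E E' e\<^sub>1 \<one> n" "local_iso E E' e\<^sub>2 \<one> n" "\<rho> + length w \<le> n"
    "\<And>h. h \<in> F \<Longrightarrow> e\<^sub>1 h = e\<^sub>2 h" "w \<in> words X" "h \<in> F"
  shows "e\<^sub>1 (ev w \<otimes> h) = e\<^sub>2 (ev w \<otimes> h)"
  using assms
proof (induction w arbitrary: e\<^sub>1 e\<^sub>2 n)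
  case Nil
  then show ?case using F_carrier by (auto simp: ev_Nil)
next
  case (Cons a w)
  obtain m where m: "n = Suc m" using Cons.prems(3) by (cases n) auto
  have aw: "a \<in> X \<times> UNIV" "w \<in> words X" using Cons.prems(5) words_Cons by blast+
  have "e\<^sub>1 (ev [a] \<otimes> (ev w \<otimes> h)) = e\<^sub>2 (ev [a] \<otimes> (ev w \<otimes> h))"
  proof (rule Cons.IH[of "\<lambda>h. e\<^sub>1 (ev [a] \<otimes> h)" m "\<lambda>h. e\<^sub>2 (ev [a] \<otimes> h)"])
    show "local_iso E E' (\<lambda>h. e\<^sub>1 (ev [a] \<otimes> h)) \<one> m" "local_iso E E' (\<lambda>h. e\<^sub>2 (ev [a] \<otimes> h)) \<one> m"
      using local_iso_shift_letter aw(1) Cons.prems(1,2) m by simp_all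
    show "e\<^sub>1 (ev [a] \<otimes> h) = e\<^sub>2 (ev [a] \<otimes> h)" if "h \<in> F" for h
      using local_iso_rigid[OF Cons.prems(1,2) _ Cons.prems(4) aw(1) that] Cons.prems(3) by simp
  qed (use Cons.prems m aw in auto)
  then show ?case
    using aw Cons.prems(6) F_carrier letter_closed ev_closed by (simp add: ev_Cons m_assoc subset_iff)
qed

end

section \<open>The action on germs of charts, and the covering map\<close>

locale rigid_cayley_target = rigid_cayley G X Rel ev S F K \<rho> R
  for G (structure) and X :: "'x set" and Rel ev S F K \<rho> R +
  fixes Y :: "'v pair_pre_digraph"
  assumes Y: "connected_simple_graph Y"
    and charts: "y \<in> pverts Y \<Longrightarrow> \<exists>e. local_iso E (parcs Y) e \<one> (Suc R) \<and> e \<one> = y"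
begin

abbreviation E' where "E' \<equiv> parcs Y"

definition chart :: "('a \<Rightarrow> 'v) \<Rightarrow> bool" where
  "chart e \<longleftrightarrow> local_iso E E' e \<one> (Suc R) \<and> e \<one> \<in> pverts Y"

text \<open>The choice does not matter: by \<open>local_iso_rigid\<close> the result depends on the germ only.\<close>

definition act :: "'x \<times> bool \<Rightarrow> ('a \<Rightarrow> 'v) \<Rightarrow> 'a \<Rightarrow> 'v" where
  "act a \<xi> = restrict (\<lambda>h. (SOME e. chart e \<and> restrict e F = \<xi>) (ev [a] \<otimes> h)) F"

definition germs :: "('a \<Rightarrow> 'v) set" where
  "germs = (\<lambda>e. restrict e F) ` Collect chart"

lemma germ_eqD: "restrict e F = restrict e' F \<Longrightarrow> h \<in> F \<Longrightarrow> e h = e' h"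
  by (metis restrict_apply')

lemma act_germ:
  assumes e: "chart e" and a: "a \<in> X \<times> UNIV"
  shows "act a (restrict e F) = restrict (\<lambda>h. e (ev [a] \<otimes> h)) F"
proof -
  define e' where "e' = (SOME e'. chart e' \<and> restrict e' F = restrict e F)"
  have e': "chart e' \<and> restrict e' F = restrict e F"
    unfolding e'_def by (rule someI[of _ e]) (use e in simp)
  have "e' (ev [a] \<otimes> h) = e (ev [a] \<otimes> h)" if "h \<in> F" for h
  proof (rule local_iso_rigid[OF _ _ _ _ a that])
    show "local_iso E E' e' \<one> (Suc R)" "local_iso E E' e \<one> (Suc R)" using e e' by (auto simp: chart_def)
    show "\<rho> \<le> Suc R" using R by simp
    show "e' h = e h" if "h \<in> F" for h using e' germ_eqD that by blast
  qed
  then show ?thesis unfolding act_def e'_def[symmetric] by (rule restrict_ext)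
qed

text \<open>Translating \<open>e\<close> by a letter loses one unit of radius; comparing with a chart at the new
  base point and using \<open>R_extend\<close> restores it without changing the germ.\<close>

lemma chart_move:
  assumes e: "chart e" and a: "a \<in> X \<times> UNIV"
  shows "\<exists>e'. chart e' \<and> (\<forall>h\<in>F. e' h = e (ev [a] \<otimes> h))"
proof -
  let ?e = "\<lambda>h. e (ev [a] \<otimes> h)"
  have ac: "ev [a] \<in> carrier G" by (rule letter_closed[OF a])
  have iso: "local_iso E E' ?e \<one> R"
    by (rule local_iso_shift_letter[OF _ a]) (use e in \<open>simp add: chart_def\<close>)
  have "e (ev [a]) \<in> edge_ball E' (e \<one>) (Suc R)"
  proof -
    have "ev [a] \<in> edge_ball E \<one> (Suc R)"
      using letter_ball[OF a] edge_ball_mono[of 1 "Suc R" E \<one>] by auto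
    then show ?thesis using e local_isoD(2)[of E E' e \<one> "Suc R"] by (auto simp: chart_def)
  qed
  then have V: "?e \<one> \<in> pverts Y"
    using e ac Y pverts_graph_ball[of Y "e \<one>" "Suc R"] by (auto simp: chart_def graph_ball_def Let_def)
  then obtain f where f: "local_iso E E' f \<one> (Suc R)" "f \<one> = ?e \<one>" using charts by blast
  have fR: "local_iso E E' f \<one> R" by (rule local_iso_antimono[OF f(1)]) simp
  let ?i = "inv_into (edge_ball E \<one> R) f"
  have i: "local_iso E' E ?i (?e \<one>) R" using local_iso_inverse[OF fR] f(2) by simp
  have "?i (?e \<one>) = \<one>" using local_isoD(1)[OF fR] by (simp add: f(2)[symmetric])
  \<comment> \<open>The inverse of \<open>f\<close> after \<open>?e\<close> is a self-isomorphism of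
    radius \<open>R\<close> fixing \<open>\<one>\<close>. Its extension \<open>\<Psi>\<close> has
    the same germ, so \<open>f\<close> after \<open>\<Psi>\<close> is a chart of full radius that
    agrees with \<open>?e\<close> on \<open>F\<close>.\<close>
  then obtain \<Psi> where \<Psi>: "local_iso E E \<Psi> \<one> (Suc R)" "\<And>h. h \<in> F \<Longrightarrow> \<Psi> h = ?i (?e h)"
    using R_extend[OF local_iso_comp[OF iso i]] by blast
  have \<Psi>1: "\<Psi> \<one> = \<one>" using \<Psi>(2)[OF one_F] \<open>?i (?e \<one>) = \<one>\<close> by simp
  have "f (\<Psi> h) = ?e h" if h: "h \<in> F" for h
  proof -
    have "h \<in> edge_ball E \<one> R" using h \<rho>(1) edge_ball_mono[of \<rho> R E \<one>] R by auto
    then have "?e h \<in> edge_ball E' (?e \<one>) R" using local_isoD(2)[OF iso] by blast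
    then have "?e h \<in> f ` edge_ball E \<one> R" using local_isoD(2)[OF fR] f(2) by simp
    then show ?thesis unfolding \<Psi>(2)[OF h] by (rule f_inv_into_f)
  qed
  moreover have "chart (\<lambda>h. f (\<Psi> h))"
    unfolding chart_def using local_iso_comp[OF \<Psi>(1), of E' f] f \<Psi>1 V by simp
  ultimately show ?thesis by blast
qed

text \<open>Each letter replaces the chart by a new one that is only known to match the translated
  old one on \<open>F\<close>. As \<open>\<rho> + K \<le> R\<close>, rigidity along the rest of a
  short word keeps the two equal where needed, so the result can be read off the original chart.
  \<open>fold\<close> applies the first letter first, which matches \<open>ev\<close> on
  concatenations.\<close>

lemma fold_act_germ:
  assumes "w \<in> words X" "length w \<le> K" "chart e"
  shows "fold act w (restrict e F) = restrict (\<lambda>h. e (ev w \<otimes> h)) F"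
  using assms
proof (induction w arbitrary: e)
  case Nil
  then show ?case using F_carrier by (auto simp: ev_Nil subset_iff intro!: restrict_ext)
next
  case (Cons a w)
  have aw: "a \<in> X \<times> UNIV" "w \<in> words X" using Cons.prems(1) words_Cons by blast+
  obtain e' where e': "chart e'" "\<And>h. h \<in> F \<Longrightarrow> e' h = e (ev [a] \<otimes> h)"
    using chart_move[OF Cons.prems(3) aw(1)] by blast
  have IH: "fold act w (restrict e' F) = restrict (\<lambda>h. e' (ev w \<otimes> h)) F"
    by (rule Cons.IH[OF aw(2) _ e'(1)]) (use Cons.prems(2) in simp)
  have act: "act a (restrict e F) = restrict e' F"
    unfolding act_germ[OF Cons.prems(3) aw(1)] by (rule restrict_ext) (simp add: e'(2))
  have "fold act (a # w) (restrict e F) = restrict (\<lambda>h. e' (ev w \<otimes> h)) F"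
    by (simp only: fold_Cons comp_apply act IH)
  moreover
  have "e' (ev w \<otimes> h) = e (ev (a # w) \<otimes> h)" if h: "h \<in> F" for h
  proof -
    \<comment> \<open>\<open>e'\<close> was chosen to agree with the translate of \<open>e\<close>
      on \<open>F\<close>; rigidity extends this to the translate of \<open>F\<close> by
      \<open>ev w\<close>, at radius \<open>R\<close>.\<close>
    have "e' (ev w \<otimes> h) = e (ev [a] \<otimes> (ev w \<otimes> h))"
    proof (rule local_iso_rigid_word[of E' e' R "\<lambda>h. e (ev [a] \<otimes> h)" w h])
      show "local_iso E E' e' \<one> R" using e'(1) local_iso_antimono[of E E' e' \<one> "Suc R" R] by (simp add: chart_def)
      show "local_iso E E' (\<lambda>h. e (ev [a] \<otimes> h)) \<one> R"
        by (rule local_iso_shift_letter[OF _ aw(1)]) (use Cons.prems(3) in \<open>simp add: chart_def\<close>)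
    qed (use R Cons.prems(2) e'(2) aw h in auto)
    then show ?thesis
      using aw h F_carrier letter_closed ev_closed by (simp add: ev_Cons m_assoc subset_iff)
  qed
  then have "restrict (\<lambda>h. e' (ev w \<otimes> h)) F = restrict (\<lambda>h. e (ev (a # w) \<otimes> h)) F"
    by (rule restrict_ext)
  ultimately show ?case by (rule trans)
qed

lemma act_germs: "\<xi> \<in> germs \<Longrightarrow> a \<in> X \<times> UNIV \<Longrightarrow> act a \<xi> \<in> germs"
proof -
  assume "\<xi> \<in> germs" and a: "a \<in> X \<times> UNIV"
  then obtain e where e: "chart e" "\<xi> = restrict e F" by (auto simp: germs_def)
  obtain e' where e': "chart e'" "\<And>h. h \<in> F \<Longrightarrow> e' h = e (ev [a] \<otimes> h)"
    using chart_move[OF e(1) a] by blast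
  have "act a \<xi> = restrict e' F"
    unfolding e(2) act_germ[OF e(1) a] by (rule restrict_ext) (simp add: e'(2))
  then show ?thesis using e'(1) by (auto simp: germs_def)
qed

lemma fold_act_germs: "w \<in> words X \<Longrightarrow> \<xi> \<in> germs \<Longrightarrow> fold act w \<xi> \<in> germs"
  by (induction w arbitrary: \<xi>) (simp_all add: words_Cons act_germs)

lemma fold_act_short:
  assumes w: "w \<in> words X" "length w \<le> K" "ev w = \<one>" and \<xi>: "\<xi> \<in> germs"
  shows "fold act w \<xi> = \<xi>"
proof -
  obtain e where e: "chart e" "\<xi> = restrict e F" using \<xi> by (auto simp: germs_def)
  have "e (\<one> \<otimes> h) = e h" if "h \<in> F" for h using that F_carrier by auto
  then show ?thesis
    unfolding e(2) fold_act_germ[OF w(1,2) e(1)] w(3) by (rule restrict_ext)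
qed

text \<open>A cancelling pair is a word of length 2 and value \<open>\<one>\<close>, and
  \<open>2 \<le> K\<close>, so it fixes the germ reached after \<open>u\<close>.\<close>

lemma fold_act_free_eq: "free_eq X u v \<Longrightarrow> \<xi> \<in> germs \<Longrightarrow> fold act u \<xi> = fold act v \<xi>"
proof (induction rule: free_eq.induct)
  case (free_cancel u v x b)
  let ?w = "[(x, b), (x, \<not> b)]"
  have w: "?w \<in> words X" using free_cancel by (auto simp: words_def)
  have "ev ?w = ev []"
    using ev_free_eq[OF free_eq.free_cancel[OF Nil_words Nil_words, of x b]] free_cancel by simp
  then have "fold act ?w (fold act u \<xi>) = fold act u \<xi>"
    using free_cancel w K(1) by (intro fold_act_short fold_act_germs) (auto simp: ev_Nil)
  then show ?case by simp
qed auto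

lemma normal_word_set_trivial_action:
  "normal_word_set X {w \<in> words X. \<forall>\<xi>\<in>germs. fold act w \<xi> = \<xi>}" (is "normal_word_set X ?M")
proof
  show "?M \<subseteq> words X" by blast
  show "[] \<in> ?M" using Nil_words by simp
  show "u @ v \<in> ?M" if "u \<in> ?M" "v \<in> ?M" for u v using that by (simp add: words_append)
  show "v \<in> ?M" if "u \<in> ?M" "free_eq X u v" for u v
    using that free_eq_words[OF that(2)] fold_act_free_eq[OF that(2)] by simp
  show "v \<in> ?M" if "u \<in> ?M" "free_eq X (u @ v) []" for u v
    using that free_eq_words[OF that(2)] fold_act_free_eq[OF that(2)] by (simp add: words_append)
  show "v @ u @ v' \<in> ?M" if u: "u \<in> ?M" "free_eq X (v @ v') []" for u v v'
  proof -
    have w: "v \<in> words X" "v' \<in> words X" using free_eq_words[OF u(2)] by (auto simp: words_append)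
    have "fold act (v @ u @ v') \<xi> = \<xi>" if "\<xi> \<in> germs" for \<xi>
      using fold_act_free_eq[OF u(2) that] u(1) fold_act_germs[OF w(1) that] by simp
    then show ?thesis using w u(1) by (simp add: words_append)
  qed
qed

text \<open>Here the presentation enters. Relators are short and so act trivially by comparison
  inside one chart; words of trivial value follow whatever their length, although no single chart
  could cover them.\<close>

lemma fold_act_trivial:
  assumes "w \<in> words X" "ev w = \<one>" "\<xi> \<in> germs"
  shows "fold act w \<xi> = \<xi>"
proof -
  have "Rel \<subseteq> {w \<in> words X. \<forall>\<xi>\<in>germs. fold act w \<xi> = \<xi>}"
  proof
    fix r assume r: "r \<in> Rel"
    then have "r \<in> words X" using Rel_words by blast
    then show "r \<in> {w \<in> words X. \<forall>\<xi>\<in>germs. fold act w \<xi> = \<xi>}"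
      using fold_act_short K(2)[OF r] ev_Rel[OF r] by simp
  qed
  then show ?thesis using presentation[OF normal_word_set_trivial_action _ assms(1,2)] assms(3) by simp
qed

text \<open>Take \<open>v'\<close> with value inverse to that of \<open>v\<close>. Both
  \<open>u @ v'\<close> and \<open>v' @ v\<close> act trivially, so acting by \<open>u\<close>,
  \<open>v'\<close>, \<open>v\<close> in turn gives the germ of \<open>u\<close> and the germ of
  \<open>v\<close>. Thus the action depends only on the group element.\<close>

lemma fold_act_cong:
  assumes u: "u \<in> words X" and v: "v \<in> words X" and eq: "ev u = ev v" and \<xi>: "\<xi> \<in> germs"
  shows "fold act u \<xi> = fold act v \<xi>"
proof -
  have vc: "ev v \<in> carrier G" using ev_closed[OF v] .
  then have "inv (ev v) \<in> ev ` words X" unfolding ev_onto by simp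
  then obtain v' where v': "v' \<in> words X" "ev v' = inv (ev v)" by force
  have "fold act (u @ v') \<xi> = \<xi>"
    by (rule fold_act_trivial) (use u v' eq \<xi> vc in \<open>simp_all add: words_append ev_append\<close>)
  then have "fold act v \<xi> = fold act v (fold act v' (fold act u \<xi>))" by simp
  also have "\<dots> = fold act (v' @ v) (fold act u \<xi>)" by simp
  also have "\<dots> = fold act u \<xi>"
    by (rule fold_act_trivial) (use u v v' \<xi> vc in \<open>simp_all add: words_append ev_append fold_act_germs\<close>)
  finally show ?thesis ..
qed

lemma covers: "graph_covers (Cay G S) Y"
proof -
  obtain y0 where "y0 \<in> pverts Y" using Y by (auto simp: connected_simple_graph_iff)
  then obtain e0 where e0: "chart e0" using charts unfolding chart_def by blast
  define \<xi>0 where "\<xi>0 = restrict e0 F"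
  have \<xi>0: "\<xi>0 \<in> germs" using e0 by (auto simp: \<xi>0_def germs_def)
  \<comment> \<open>The value at \<open>\<one>\<close> is the base point of the germ reached by
    acting with \<open>g\<close>; \<open>fold_act_cong\<close> makes the chosen word
    irrelevant.\<close>
  define p where "p g = fold act (SOME w. w \<in> words X \<and> ev w = g) \<xi>0 \<one>" for g
  have p: "p (ev w) = fold act w \<xi>0 \<one>" if w: "w \<in> words X" for w
  proof -
    let ?w = "SOME w'. w' \<in> words X \<and> ev w' = ev w"
    have "?w \<in> words X \<and> ev ?w = ev w" by (rule someI[of _ w]) (use w in simp)
    then show ?thesis using fold_act_cong[of ?w w \<xi>0] w \<xi>0 by (simp add: p_def)
  qed
  \<comment> \<open>Near \<open>g\<close> the map \<open>p\<close> is one chart after translation by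
    \<open>inv g\<close>. This works because each \<open>s\<close> in \<open>S\<close> is the value
    of a word short enough for \<open>fold_act_germ\<close>.\<close>
  have step: "\<exists>e. chart e \<and> e \<one> = p g \<and> (\<forall>s\<in>S. p (g \<otimes> s) = e s)" if g: "g \<in> carrier G" for g
  proof -
    have "g \<in> ev ` words X" using g unfolding ev_onto .
    then obtain w where w: "w \<in> words X" "ev w = g" by blast
    have "fold act w \<xi>0 \<in> germs" by (rule fold_act_germs[OF w(1) \<xi>0])
    then obtain e where e: "chart e" "fold act w \<xi>0 = restrict e F" unfolding germs_def by blast
    have "p (g \<otimes> s) = e s" if s: "s \<in> S" for s
    proof -
      obtain v where v: "v \<in> words X" "length v \<le> K" "ev v = s" using K(3)[OF s] by blast
      have "p (ev (w @ v)) = fold act v (restrict e F) \<one>"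
        using p[of "w @ v"] w(1) v(1) e(2) by (simp add: words_append)
      also have "\<dots> = e (s \<otimes> \<one>)" using fold_act_germ[OF v(1,2) e(1)] one_F v(3) by simp
      also have "\<dots> = e s" using s S_carrier by (simp add: subset_iff)
      finally show ?thesis using ev_append[OF w(1) v(1)] w(2) v(3) by simp
    qed
    moreover have "e \<one> = p g" using p[OF w(1)] w(2) e(2) one_F by simp
    ultimately show ?thesis using e(1) by blast
  qed
  have nbrs: "bij_betw e S (neighbours Y (e \<one>))" if e: "chart e" for e
  proof -
    have iso: "local_iso E E' e \<one> 1"
      using e local_iso_antimono[of E E' e \<one> "Suc R" 1] by (simp add: chart_def)
    note D = local_isoD[OF iso]
    have E1: "(\<one>, s) \<in> E \<longleftrightarrow> s \<in> S" for s using S_carrier by (auto simp: Cay_edge_iff)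
    have S1: "s \<in> edge_ball E \<one> 1" if "s \<in> S" for s using E1[of s] that by (auto simp: edge_ball_Suc)
    have "inj_on e S" using D(1) S1 by (meson inj_on_subset subsetI)
    moreover have "e s \<in> neighbours Y (e \<one>)" if "s \<in> S" for s
      using D(3)[OF _ S1[OF that], of \<one>] E1 that by (simp add: neighbours_def)
    moreover have "z \<in> e ` S" if "z \<in> neighbours Y (e \<one>)" for z
    proof -
      have z: "(e \<one>, z) \<in> E'" using that by (simp add: neighbours_def)
      then have "z \<in> edge_ball E' (e \<one>) 1" by (auto simp: edge_ball_Suc)
      then obtain s where s: "s \<in> edge_ball E \<one> 1" "z = e s" using D(2) by blast
      then have "(\<one>, s) \<in> E" using D(3)[OF _ s(1), of \<one>] z by simp
      then show ?thesis using E1 s(2) by blast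
    qed
    ultimately show ?thesis by (auto simp: bij_betw_def)
  qed
  have Yv: "pverts (Cay G S) = carrier G" by (simp add: Cay_def)
  have pV: "p g \<in> pverts Y" if "g \<in> carrier G" for g using step[OF that] by (auto simp: chart_def)
  have cover: "bij_betw p (neighbours (Cay G S) g) (neighbours Y (p g))" if g: "g \<in> carrier G" for g
  proof -
    obtain e where e: "chart e" "e \<one> = p g" "\<And>s. s \<in> S \<Longrightarrow> p (g \<otimes> s) = e s" using step[OF g] by blast
    have cancel: "g \<otimes> (inv g \<otimes> h) = h" "inv g \<otimes> (g \<otimes> h) = h" if "h \<in> carrier G" for h
      using g that by (simp_all add: m_assoc[symmetric])
    have N: "h \<in> neighbours (Cay G S) g \<longleftrightarrow> h \<in> carrier G \<and> inv g \<otimes> h \<in> S" for h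
      using g by (simp add: neighbours_def Cay_edge_iff)
    have "bij_betw (\<lambda>h. inv g \<otimes> h) (neighbours (Cay G S) g) S"
    proof (rule bij_betw_byWitness[where f' = "\<lambda>s. g \<otimes> s"])
      show "\<forall>h\<in>neighbours (Cay G S) g. g \<otimes> (inv g \<otimes> h) = h" using N cancel by blast
      show "\<forall>s\<in>S. inv g \<otimes> (g \<otimes> s) = s" using S_carrier cancel by blast
      show "(\<lambda>h. inv g \<otimes> h) ` neighbours (Cay G S) g \<subseteq> S" using N by blast
      show "(\<lambda>s. g \<otimes> s) ` S \<subseteq> neighbours (Cay G S) g"
        using N g subsetD[OF S_carrier] cancel by (intro image_subsetI) simp
    qed
    then have "bij_betw (e \<circ> (\<lambda>h. inv g \<otimes> h)) (neighbours (Cay G S) g) (neighbours Y (p g))"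
      using nbrs[OF e(1)] e(2) by (simp add: bij_betw_trans)
    moreover have "(e \<circ> (\<lambda>h. inv g \<otimes> h)) h = p h" if "h \<in> neighbours (Cay G S) g" for h
    proof -
      have h: "h \<in> carrier G" "inv g \<otimes> h \<in> S" using that N by auto
      show ?thesis using e(3)[OF h(2)] cancel(1)[OF h(1)] by simp
    qed
    ultimately show ?thesis using bij_betw_cong by metis
  qed
  \<comment> \<open>Surjectivity: the image is closed under adjacency, since neighbours of
    \<open>g\<close> map onto neighbours of \<open>p g\<close>, and \<open>Y\<close> is
    connected.\<close>
  have "z \<in> p ` carrier G" if "(y, z) \<in> E'\<^sup>*" "y \<in> p ` carrier G" for y z
    using that
  proof induction
    case (step z z')
    then obtain g where g: "g \<in> carrier G" "z = p g" by blast
    then have "z' \<in> p ` neighbours (Cay G S) g"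
      using cover[OF g(1)] step by (auto simp: bij_betw_def neighbours_def)
    moreover have "neighbours (Cay G S) g \<subseteq> carrier G" by (auto simp: neighbours_def Cay_edge_iff)
    ultimately show ?case by blast
  qed
  moreover have "(p \<one>, z) \<in> E'\<^sup>*" if "z \<in> pverts Y" for z
    using Y pV[OF one_closed] that by (auto simp: connected_simple_graph_iff)
  ultimately have "p ` carrier G = pverts Y" using pV one_closed by blast
  then show ?thesis unfolding graph_covers_def Yv using cover by blast
qed

end

section \<open>The radius at which germs of self-isomorphisms stabilise\<close>

context group begin

lemma finite_edge_ball_Cay:
  assumes "finite S" "g \<in> carrier G"
  shows "finite (edge_ball (parcs (Cay G S)) g n)"
proof (induction n)
  case (Suc n)
  have "parcs (Cay G S) `` edge_ball (parcs (Cay G S)) g n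
      \<subseteq> (\<lambda>(u, s). u \<otimes> s) ` (edge_ball (parcs (Cay G S)) g n \<times> S)"
  proof
    fix v assume "v \<in> parcs (Cay G S) `` edge_ball (parcs (Cay G S)) g n"
    then obtain u where u: "u \<in> edge_ball (parcs (Cay G S)) g n" "u \<in> carrier G" "v \<in> carrier G"
      "inv u \<otimes> v \<in> S" by (auto simp: Cay_edge_iff)
    have "v = u \<otimes> (inv u \<otimes> v)" using u(2,3) by (simp add: m_assoc[symmetric])
    then show "v \<in> (\<lambda>(u, s). u \<otimes> s) ` (edge_ball (parcs (Cay G S)) g n \<times> S)"
      using u(1,4) by force
  qed
  then show ?case
    unfolding edge_ball_Suc using Suc.IH assms(1) by (meson finite_UnI finite_SigmaI finite_imageI finite_subset)
qed simp

text \<open>The germs on \<open>F\<close> of radius-\<open>n\<close> self-isomorphisms fixing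
  \<open>\<one>\<close> shrink as \<open>n\<close> grows. From radius \<open>\<rho>\<close> on they
  send \<open>F\<close> into the ball of radius \<open>\<rho>\<close>, so there are finitely many
  and two consecutive radii give the same germs. Only the germ is extended; \<open>\<Psi>\<close>
  may differ from \<open>\<psi>\<close> outside \<open>F\<close>.\<close>

lemma local_iso_extension_radius:
  assumes S: "finite S" and F: "finite F" "F \<subseteq> edge_ball (parcs (Cay G S)) \<one> \<rho>" and m: "\<rho> \<le> m"
  shows "\<exists>R\<ge>m. \<forall>\<psi>. local_iso (parcs (Cay G S)) (parcs (Cay G S)) \<psi> \<one> R \<longrightarrow> \<psi> \<one> = \<one> \<longrightarrow>
    (\<exists>\<Psi>. local_iso (parcs (Cay G S)) (parcs (Cay G S)) \<Psi> \<one> (Suc R) \<and> (\<forall>h\<in>F. \<Psi> h = \<psi> h))"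
proof -
  let ?E = "parcs (Cay G S)"
  define A where "A n = (\<lambda>\<psi>. restrict \<psi> F) ` {\<psi>. local_iso ?E ?E \<psi> \<one> n \<and> \<psi> \<one> = \<one>}" for n
  have "\<exists>R\<ge>m. A (Suc R) = A R"
  proof (rule decseq_finite_stabilises)
    show "A (Suc n) \<subseteq> A n" for n
      unfolding A_def using local_iso_antimono[of ?E ?E _ \<one> "Suc n" n] by auto
    show "finite (A n)" if n: "m \<le> n" for n
    proof (rule finite_subset)
      show "A n \<subseteq> F \<rightarrow>\<^sub>E edge_ball ?E \<one> \<rho>"
      proof
        fix \<xi> assume "\<xi> \<in> A n"
        then obtain \<psi> where \<psi>: "local_iso ?E ?E \<psi> \<one> n" "\<psi> \<one> = \<one>" "\<xi> = restrict \<psi> F"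
          by (auto simp: A_def)
        have "local_iso ?E ?E \<psi> \<one> \<rho>" by (rule local_iso_antimono[OF \<psi>(1)]) (use m n in simp)
        then have "\<psi> h \<in> edge_ball ?E \<one> \<rho>" if "h \<in> F" for h
          using local_isoD(2)[of ?E ?E \<psi> \<one> \<rho>] F(2) that \<psi>(2) by auto
        then show "\<xi> \<in> F \<rightarrow>\<^sub>E edge_ball ?E \<one> \<rho>" unfolding \<psi>(3) by auto
      qed
      show "finite (F \<rightarrow>\<^sub>E edge_ball ?E \<one> \<rho>)"
        using F(1) finite_edge_ball_Cay[OF S one_closed] by (intro finite_PiE) auto
    qed
  qed
  then obtain R where R: "R \<ge> m" "A (Suc R) = A R" by blast
  have "\<exists>\<Psi>. local_iso ?E ?E \<Psi> \<one> (Suc R) \<and> (\<forall>h\<in>F. \<Psi> h = \<psi> h)"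
    if "local_iso ?E ?E \<psi> \<one> R" "\<psi> \<one> = \<one>" for \<psi>
  proof -
    have "restrict \<psi> F \<in> A (Suc R)" unfolding R(2) using that by (auto simp: A_def)
    then obtain \<Psi> where \<Psi>: "local_iso ?E ?E \<Psi> \<one> (Suc R)" "restrict \<psi> F = restrict \<Psi> F"
      by (auto simp: A_def)
    have "\<Psi> h = \<psi> h" if "h \<in> F" for h using fun_cong[OF \<Psi>(2), of h] that by simp
    then show ?thesis using \<Psi>(1) by blast
  qed
  then show ?thesis using R(1) by blast
qed

end

section \<open>From local isomorphism to rigidity, and the choice of the constants\<close>

lemma (in rigid_cayley) LG_rigid_Cay:
  assumes X: "connected_simple_graph (Cay G S)"
  shows "LG_rigid (Cay G S)"
proof -
  have "graph_covers (Cay G S) Y"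
    if Y: "connected_simple_graph Y" and loc: "locally_graph (Suc R) Y (Cay G S)"
    for Y :: "'a list pair_pre_digraph"
  proof -
    interpret rigid_cayley_target G X Rel ev S F K \<rho> R Y
    proof
      show "connected_simple_graph Y" by (rule Y)
      fix y assume y: "y \<in> pverts Y"
      then obtain x f where x: "x \<in> pverts (Cay G S)" "f y = x"
        and f: "graph_isomorphism f (graph_ball Y y (Suc R)) (graph_ball (Cay G S) x (Suc R))"
        using loc unfolding locally_graph_def by blast
      have xc: "x \<in> carrier G" using x(1) by (simp add: Cay_def)
      have f': "local_iso (parcs Y) E f y (Suc R)"
        by (rule graph_isomorphism_local_iso[OF Y y X x(1) f x(2)])
      \<comment> \<open>The local hypothesis maps \<open>Y\<close> to the Cayley graph. A chart is
        the inverse map, precomposed with translation by \<open>x\<close> to move its base point to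
        \<open>\<one>\<close>.\<close>
      define i where "i = inv_into (edge_ball (parcs Y) y (Suc R)) f"
      have i: "local_iso E (parcs Y) i x (Suc R)"
        using local_iso_inverse[OF f'] by (simp add: x(2) i_def)
      have ix: "i x = y" using local_isoD(1)[OF f'] by (simp add: x(2)[symmetric] i_def)
      have "local_iso E (parcs Y) (\<lambda>h. i (x \<otimes> h)) \<one> (Suc R)"
        by (rule local_iso_comp[OF local_iso_translation[OF xc one_closed]]) (use i xc in simp)
      moreover have "i (x \<otimes> \<one>) = y" using ix xc by simp
      ultimately show "\<exists>e. local_iso E (parcs Y) e \<one> (Suc R) \<and> e \<one> = y" by blast
    qed
    show ?thesis by (rule covers)
  qed
  then show ?thesis unfolding LG_rigid_def LG_rigid_at_def by blast
qed

theorem corollary1p4: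
  fixes G (structure)
  assumes "group G" and "finitely_presented G"
  shows "\<exists>S. finite S \<and> S \<subseteq> carrier G - {\<one>} \<and> m_inv G ` S = S \<and>
    generate G S = carrier G \<and> LG_rigid (Cay G S)"
proof -
  interpret group G by fact
  obtain X :: "nat set" and Rel ev where
    fin: "finite X" "finite Rel" and Rel: "Rel \<subseteq> words X"
    and ev: "\<And>w. w \<in> words X \<Longrightarrow> ev w \<in> carrier G" "ev [] = \<one>"
      "\<And>u v. u \<in> words X \<Longrightarrow> v \<in> words X \<Longrightarrow> ev (u @ v) = ev u \<otimes> ev v"
      "\<And>u v. free_eq X u v \<Longrightarrow> ev u = ev v" "ev ` words X = carrier G"
      "\<And>r. r \<in> Rel \<Longrightarrow> ev r = \<one>"
    and pres: "\<And>M w. normal_word_set X M \<Longrightarrow> Rel \<subseteq> M \<Longrightarrow> w \<in> words X \<Longrightarrow> ev w = \<one> \<Longrightarrow> w \<in> M"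
    using finitely_presented_words[OF assms] by blast
  define T where "T = (\<lambda>a. ev [a]) ` (X \<times> UNIV)"
  have nil: "[] \<in> words X" by (simp add: words_def)
  have letter: "[a] \<in> words X" if "a \<in> X \<times> UNIV" for a using that by (simp add: words_def)
  have Tf: "finite T" using fin(1) by (simp add: T_def)
  have Tc: "T \<subseteq> carrier G" using ev(1) letter by (auto simp: T_def)
  have Tinv: "inv (ev [(x, b)]) = ev [(x, \<not> b)]" if x: "x \<in> X" for x b
  proof -
    have w: "[(x, b)] \<in> words X" "[(x, \<not> b)] \<in> words X" using x by (simp_all add: letter)
    have "free_eq X ([] @ [(x, \<not> b), (x, \<not> \<not> b)] @ []) ([] @ [])" by (rule free_cancel[OF nil nil x])
    then have "ev ([(x, \<not> b)] @ [(x, b)]) = \<one>" using ev(4) ev(2) by fastforce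
    then have "ev [(x, \<not> b)] \<otimes> ev [(x, b)] = \<one>" using ev(3)[OF w(2,1)] by simp
    then show ?thesis using ev(1)[OF w(1)] ev(1)[OF w(2)] inv_equality by blast
  qed
  have Tsym: "m_inv G ` T = T"
  proof
    show sub: "m_inv G ` T \<subseteq> T" using Tinv by (auto simp: T_def)
    show "T \<subseteq> m_inv G ` T"
    proof
      fix t assume t: "t \<in> T"
      then have "inv t \<in> T" using sub by blast
      moreover have "t = inv (inv t)" using t Tc by auto
      ultimately show "t \<in> m_inv G ` T" by (rule rev_image_eqI)
    qed
  qed
  have "ev w \<in> generate G T" if "w \<in> words X" for w
    using that
  proof (induction w)
    case Nil
    then show ?case by (simp add: ev(2) generate.one)
  next
    case (Cons a w)
    then have a: "a \<in> X \<times> UNIV" "w \<in> words X" by (auto simp: words_def)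
    then have "ev (a # w) = ev [a] \<otimes> ev w" using ev(3)[OF letter[OF a(1)] a(2)] by simp
    moreover have "ev [a] \<in> generate G T" using a(1) by (intro generate.incl) (simp add: T_def)
    ultimately show ?case using Cons.IH[OF a(2)] by (simp add: generate.eng)
  qed
  then have "carrier G \<subseteq> generate G T" unfolding ev(5)[symmetric] by blast
  then have Tgen: "generate G T = carrier G" using generate_incl[OF Tc] by blast
  obtain S F where S: "finite S" "S \<subseteq> carrier G - {\<one>}" "m_inv G ` S = S" "T - {\<one>} \<subseteq> S"
    and F: "finite F" "F \<subseteq> carrier G" "\<one> \<in> F" "separating_set S T F"
    using exists_separating_set[OF Tf Tc Tsym Tgen] by blast
  have Sc: "S \<subseteq> carrier G" using S(2) by blast
  \<comment> \<open>A generator of the presentation may be trivial in \<open>G\<close>, but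
    \<open>S\<close> must omit \<open>\<one>\<close>.\<close>
  have TS: "T \<subseteq> insert \<one> S" using S(4) by blast
  have Sgen: "generate G S = carrier G"
  proof
    show "generate G S \<subseteq> carrier G" by (rule generate_incl[OF Sc])
    have "T \<subseteq> generate G S" using TS generate.one[of G S] generate.incl[of _ S G] by blast
    then show "carrier G \<subseteq> generate G S"
      using generate_subgroup_incl[OF _ generate_is_subgroup[OF Sc]] Tgen by blast
  qed
  have conn: "connected_simple_graph (Cay G S)"
    by (rule connected_simple_graph_Cay[OF assms(1) S(2,3) Sgen])
  have "\<forall>s\<in>S. \<exists>w. w \<in> words X \<and> ev w = s"
  proof
    fix s assume "s \<in> S"
    then have "s \<in> ev ` words X" using Sc unfolding ev(5) by blast
    then show "\<exists>w. w \<in> words X \<and> ev w = s" by blast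
  qed
  then obtain word where word: "\<And>s. s \<in> S \<Longrightarrow> word s \<in> words X \<and> ev (word s) = s" by metis
  \<comment> \<open>The inserted 2 provides for cancelling pairs and keeps the set nonempty for
    \<open>Max\<close>.\<close>
  define K where "K = Max (insert 2 (length ` (Rel \<union> word ` S)))"
  have K: "2 \<le> K" "\<And>w. w \<in> Rel \<union> word ` S \<Longrightarrow> length w \<le> K"
    unfolding K_def using fin(2) S(1) by (auto intro!: Max_ge)
  have "\<exists>n. F \<union> (\<lambda>(t, h). t \<otimes> h) ` (T \<times> F) \<subseteq> edge_ball (parcs (Cay G S)) \<one> n"
  proof (rule finite_in_edge_ball)
    show "finite (F \<union> (\<lambda>(t, h). t \<otimes> h) ` (T \<times> F))" using F(1) Tf by simp
    fix y assume "y \<in> F \<union> (\<lambda>(t, h). t \<otimes> h) ` (T \<times> F)"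
    then have "y \<in> carrier G" using F(2) Tc by auto
    then show "(\<one>, y) \<in> (parcs (Cay G S))\<^sup>*"
      using conn unfolding connected_simple_graph_iff by (simp add: Cay_def)
  qed
  then obtain \<rho> where \<rho>: "F \<union> (\<lambda>(t, h). t \<otimes> h) ` (T \<times> F) \<subseteq> edge_ball (parcs (Cay G S)) \<one> \<rho>" by blast
  then have \<rho>F: "F \<subseteq> edge_ball (parcs (Cay G S)) \<one> \<rho>" by blast
  \<comment> \<open>The stabilisation radius is sought only from \<open>\<rho> + K\<close> on, so
    that the short words also fit into a chart.\<close>
  obtain R where R: "\<rho> + K \<le> R"
    "\<And>\<psi>. local_iso (parcs (Cay G S)) (parcs (Cay G S)) \<psi> \<one> R \<Longrightarrow> \<psi> \<one> = \<one> \<Longrightarrow>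
      \<exists>\<Psi>. local_iso (parcs (Cay G S)) (parcs (Cay G S)) \<Psi> \<one> (Suc R) \<and> (\<forall>h\<in>F. \<Psi> h = \<psi> h)"
    using local_iso_extension_radius[OF S(1) F(1) \<rho>F le_add1[of \<rho> K]] by blast
  interpret rigid_cayley G X Rel ev S F K \<rho> R
  proof
    show "ev [a] \<in> insert \<one> S" if "a \<in> X \<times> UNIV" for a using TS that unfolding T_def by blast
    show "separating_set S ((\<lambda>a. ev [a]) ` (X \<times> UNIV)) F" using F(4) by (simp only: T_def)
    show "length r \<le> K" if "r \<in> Rel" for r using K(2) that by blast
    show "\<exists>w\<in>words X. length w \<le> K \<and> ev w = s" if "s \<in> S" for s
      using word[OF that] K(2)[of "word s"] that by blast
    show "ev [a] \<otimes> h \<in> edge_ball (parcs (Cay G S)) \<one> \<rho>" if "a \<in> X \<times> UNIV" "h \<in> F" for a h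
    proof -
      have "(ev [a], h) \<in> T \<times> F" using that by (simp add: T_def)
      then show ?thesis using \<rho> by force
    qed
  qed (fact Rel ev pres Sc F K(1) \<rho>F R)+
  show ?thesis using S(1-3) Sgen LG_rigid_Cay[OF conn] by blast
qed

end
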